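(* Let $k\ge3$ and $n\ge 2k+6$. (a) For no configuration $\mathbf q=(q_1,\dots,q_n)$ of points in convex position in $\mathbb{R}^2$ do the rows of the cofactor rigidity matrix $C_{2k}(\mathbf q)$ realize $\overline{\Delta}_k(n)$ as a complete fan. (b) For no real parameters $t_1<\dots<t_n$ do the rows of the bar-and-joint rigidity matrix $R(p'_1,\dots,p'_n)$, with $p'_i=(t_i,t_i^2,\dots,t_i^{2k})\in\mathbb{R}^{2k}$, realize $\overline{\Delta}_k(n)$ as a complete fan; and for no real parameters $t_1<\dots<t_n$ do the rows of the hyperconnectivity matrix $H(p_1,\dots,p_n)$, with $p_i=(1,t_i,\dots,t_i^{2k-1})\in\mathbb{R}^{2k}$, realize $\overline{\Delta}_k(n)$ as a complete fan.
   Context: An edge is an element of $\binom{[n]}{2}$. Two disjoint edges $\{i,j\},\{a,b\}$ with $i<j$, $a<b$ cross if $i<a<j<b$ or $a<i<b<j$. The length of $\{i,j\}$ is $\min\{|j-i|,n-|j-i|\}$. $\overline{\Delta}_k(n)$ is the simplicial complex whose vertices are the edges of length at least $k+1$ (relevant edges) and whose faces are the sets of relevant edges containing no $k+1$ pairwise crossing edges. It is a sphere of dimension $k(n-2k-1)-1$. Convex position: $q_1,\dots,q_n$ are the distinct vertices of a convex $n$-gon, in this cyclic order. Matrices (one row per edge $\{i,j\}$, $i<j$; one block of $d$ columns per vertex; entries not mentioned are zero): - $R(p_1,\dots,p_n)$, $p_i\in\mathbb{R}^d$: row $\{i,j\}$ has $p_i-p_j$ in block $i$ and $p_j-p_i$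 in block $j$. - $H(p_1,\dots,p_n)$, $p_i\in\mathbb{R}^d$: row $\{i,j\}$ has $p_j$ in block $i$ and $-p_i$ in block $j$. - $C_d(\mathbf q)$, $q_i=(x_i,y_i)\in\mathbb{R}^2$: row $\{i,j\}$ has $\mathbf c_{ij}$ in block $i$ and $-\mathbf c_{ij}$ in block $j$, where $\mathbf c_{ij}=\big((x_i-x_j)^{d-1},(y_i-y_j)(x_i-x_j)^{d-2},\dots,(y_i-y_j)^{d-1}\big)$. Realizing as a complete fan: let $(v_e)_{e\in\binom{[n]}{2}}$ be vectors, $W$ their linear span, $W'$ the quotient of $W$ by the span of the $v_e$ with $e$ of length at most $k$, and $\bar v_e$ the image of $v_e$ in $W'$. The vectors realize $\overline{\Delta}_k(n)$ as a complete fan if $\dim W'=k(n-2k-1)$ and the cones $\operatorname{cone}(\bar v_e:e\in F)$, $F\in\overline{\Delta}_k(n)$, form a complete simplicial fan in $W'$ (for each face $F$ the vectors $\{\bar v_e\}_{e\in F}$ are linearly independent; cones of faces $F,G$ intersect exactly in the cone of $F\cap G$; the cones cover $W'$). *)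

theory Defs
  imports "HOL-Analysis.Analysis" "HOL-Library.Function_Algebras" "HOL-Library.Set_Algebras"
begin

section \<open>Functions as a real vector space\<close>

text \<open>\<^theory>\<open>HOL-Library.Function_Algebras\<close> provides the additive structure only.\<close>

instantiation "fun" :: (type, real_vector) real_vector
begin

definition scaleR_fun :: "real \<Rightarrow> ('a \<Rightarrow> 'b) \<Rightarrow> 'a \<Rightarrow> 'b" where
  "scaleR_fun a f = (\<lambda>x. a *\<^sub>R f x)"

instance
  by standard
    (auto simp: scaleR_fun_def plus_fun_def fun_eq_iff scaleR_add_right scaleR_add_left)

end


section \<open>The multiassociahedron\<close>

type_synonym edge = "nat \<times> nat"

text \<open>The 2-subset \<open>{i, j}\<close> of \<open>[n] = {1..n}\<close> is encoded by its unique increasing pair.\<close>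

definition edges :: "nat \<Rightarrow> edge set" where
  "edges n = {(i, j). 1 \<le> i \<and> i < j \<and> j \<le> n}"

text \<open>The strict inequalities force crossing edges to be disjoint.\<close>

definition crosses :: "edge \<Rightarrow> edge \<Rightarrow> bool" where
  "crosses = (\<lambda>(i, j) (a, b). (i < a \<and> a < j \<and> j < b) \<or> (a < i \<and> i < b \<and> b < j))"

definition edge_length :: "nat \<Rightarrow> edge \<Rightarrow> nat" where
  "edge_length n = (\<lambda>(i, j). min (j - i) (n - (j - i)))"

definition relevant_edges :: "nat \<Rightarrow> nat \<Rightarrow> edge set" where
  "relevant_edges k n = {e \<in> edges n. edge_length n e \<ge> k + 1}"

definition irrelevant_edges :: "nat \<Rightarrow> nat \<Rightarrow> edge set" where
  "irrelevant_edges k n = {e \<in> edges n. edge_length n e \<le> k}"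

text \<open>The set of faces of the complex \<open>\<Delta>\<close>-bar with parameters \<open>k\<close> and \<open>n\<close>.\<close>

definition reduced_multiassociahedron :: "nat \<Rightarrow> nat \<Rightarrow> edge set set" where
  "reduced_multiassociahedron k n =
     {F. F \<subseteq> relevant_edges k n \<and> \<not> (\<exists>X \<subseteq> F. card X = k + 1 \<and> pairwise crosses X)}"


section \<open>Quotient spaces\<close>

text \<open>
  The quotient \<open>W / U\<close> consists of the cosets \<open>w +o U\<close>, and its operations are computed on
  representatives: the linear combination with coefficients \<open>c i\<close> of the cosets of the vectors
  \<open>v i\<close> is the coset of \<open>\<Sum>i. c i *\<^sub>R v i\<close>, and \<open>U\<close> is the zero vector.
\<close>

definition quotient_space :: "'v::real_vector set \<Rightarrow> 'v set \<Rightarrow> 'v set set" where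
  "quotient_space W U = (\<lambda>w. w +o U) ` W"

text \<open>In the following three definitions the index set \<open>I\<close> is meant to be finite.\<close>

definition quotient_independent :: "'v::real_vector set \<Rightarrow> ('i \<Rightarrow> 'v) \<Rightarrow> 'i set \<Rightarrow> bool" where
  "quotient_independent U v I \<longleftrightarrow>
     (\<forall>c :: 'i \<Rightarrow> real. (\<Sum>i\<in>I. c i *\<^sub>R v i) +o U = U \<longrightarrow> (\<forall>i\<in>I. c i = 0))"

definition quotient_span :: "'v::real_vector set \<Rightarrow> ('i \<Rightarrow> 'v) \<Rightarrow> 'i set \<Rightarrow> 'v set set" where
  "quotient_span U v I = {(\<Sum>i\<in>I. c i *\<^sub>R v i) +o U | c :: 'i \<Rightarrow> real. True}"

definition quotient_cone :: "'v::real_vector set \<Rightarrow> ('i \<Rightarrow> 'v) \<Rightarrow> 'i set \<Rightarrow> 'v set set" where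
  "quotient_cone U v I = {(\<Sum>i\<in>I. c i *\<^sub>R v i) +o U | c :: 'i \<Rightarrow> real. \<forall>i\<in>I. 0 \<le> c i}"

text \<open>\<open>W / U\<close> has a basis of \<open>m\<close> elements, namely the cosets of \<open>b 0, \<dots>, b (m - 1)\<close>.\<close>

definition quotient_has_dim :: "'v::real_vector set \<Rightarrow> 'v set \<Rightarrow> nat \<Rightarrow> bool" where
  "quotient_has_dim W U m \<longleftrightarrow>
     (\<exists>b :: nat \<Rightarrow> 'v. b ` {..<m} \<subseteq> W \<and> quotient_independent U b {..<m} \<and>
        quotient_span U b {..<m} = quotient_space W U)"


section \<open>Realization as a complete fan\<close>

definition complete_simplicial_fan ::
    "'v::real_vector set \<Rightarrow> 'v set \<Rightarrow> ('i \<Rightarrow> 'v) \<Rightarrow> 'i set set \<Rightarrow> bool" where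
  "complete_simplicial_fan W U v \<Delta> \<longleftrightarrow>
     (\<forall>F\<in>\<Delta>. quotient_independent U v F) \<and>
     (\<forall>F\<in>\<Delta>. \<forall>G\<in>\<Delta>. quotient_cone U v F \<inter> quotient_cone U v G = quotient_cone U v (F \<inter> G)) \<and>
     (\<Union>F\<in>\<Delta>. quotient_cone U v F) = quotient_space W U"

definition realizes_as_complete_fan ::
    "nat \<Rightarrow> nat \<Rightarrow> (edge \<Rightarrow> 'v::real_vector) \<Rightarrow> bool" where
  "realizes_as_complete_fan k n v \<longleftrightarrow>
     (let W = span (v ` edges n); U = span (v ` irrelevant_edges k n) in
        quotient_has_dim W U (k * (n - 2 * k - 1)) \<and>
        complete_simplicial_fan W U v (reduced_multiassociahedron k n))"


section \<open>Rigidity matrices\<close>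

text \<open>
  Each matrix is given by its rows, indexed by the edges. A row is a function of a block (a vertex)
  and a column \<open>s < d\<close> inside that block; it vanishes at all other arguments, so that it lives in a
  copy of the \<open>n * d\<close>-dimensional coordinate space. The columns of a block are numbered from 0,
  and \<open>p i s\<close> is the coordinate with this number of the point \<open>p i\<close>.
\<close>

type_synonym row = "nat \<Rightarrow> nat \<Rightarrow> real"

definition block_row :: "nat \<Rightarrow> edge \<Rightarrow> (nat \<Rightarrow> real) \<Rightarrow> (nat \<Rightarrow> real) \<Rightarrow> row" where
  "block_row d e x y = (\<lambda>b s.
     if s < d \<and> b = fst e then x s else if s < d \<and> b = snd e then y s else 0)"

definition bar_joint_row :: "nat \<Rightarrow> (nat \<Rightarrow> nat \<Rightarrow> real) \<Rightarrow> edge \<Rightarrow> row" where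
  "bar_joint_row d p = (\<lambda>(i, j). block_row d (i, j) (\<lambda>s. p i s - p j s) (\<lambda>s. p j s - p i s))"

definition hyperconnectivity_row :: "nat \<Rightarrow> (nat \<Rightarrow> nat \<Rightarrow> real) \<Rightarrow> edge \<Rightarrow> row" where
  "hyperconnectivity_row d p = (\<lambda>(i, j). block_row d (i, j) (\<lambda>s. p j s) (\<lambda>s. - p i s))"

definition cofactor_vector :: "nat \<Rightarrow> real \<times> real \<Rightarrow> real \<times> real \<Rightarrow> nat \<Rightarrow> real" where
  "cofactor_vector d q r s = (fst q - fst r) ^ (d - 1 - s) * (snd q - snd r) ^ s"

definition cofactor_row :: "nat \<Rightarrow> (nat \<Rightarrow> real \<times> real) \<Rightarrow> edge \<Rightarrow> row" where
  "cofactor_row d q = (\<lambda>(i, j). block_row d (i, j)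
     (\<lambda>s. cofactor_vector d (q i) (q j) s) (\<lambda>s. - cofactor_vector d (q i) (q j) s))"


section \<open>Configurations\<close>

text \<open>
  The points \<open>q 1, \<dots>, q n\<close> are the distinct vertices of the polygon \<open>P\<close>, and cyclically
  consecutive ones are joined by its sides; \<open>i mod n + 1\<close> is the cyclic successor of \<open>i\<close> in
  \<open>{1..n}\<close>. Both orientations of the cyclic order are allowed.
\<close>

definition convex_position :: "nat \<Rightarrow> (nat \<Rightarrow> real \<times> real) \<Rightarrow> bool" where
  "convex_position n q \<longleftrightarrow>
     (let P = convex hull (q ` {1..n}) in
        inj_on q {1..n} \<and>
        {x. x extreme_point_of P} = q ` {1..n} \<and>
        (\<forall>i\<in>{1..n}. closed_segment (q i) (q (i mod n + 1)) edge_of P))"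

end

theory Submission
  imports Defs
begin

text \<open>
  A linear dependence among the rows is called a stress. In a realization, a stress whose positive
  relevant edges form a face and whose negative relevant edges form a face vanishes on all relevant
  edges: it gives a common point of the cones of two disjoint faces, and these cones share only
  the origin (\<open>dependence_between_faces_is_trivial\<close>). So it is enough to find one stress of this kind
  that does not vanish on the relevant edges.

  The three matrices have stresses of the same form, up to positive factors on the edges. On \<open>2k + 2\<close> of the
  points the edge \<open>ij\<close> carries \<open>1 / \<Prod>\<^sub>m [ijm]\<close>, where \<open>[ijm]\<close> is a signed area and \<open>m\<close> runs through the
  other points; the moment curve is the case of points on a parabola. Combining these stresses,
  every point \<open>p\<close> of the plane gives a stress on a set \<open>S\<close> of \<open>2k + 3\<close> points, with \<open>[ijp] / \<Prod>\<^sub>m [ijm]\<close> on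
  \<open>ij\<close>. A family of \<open>k + 1\<close> pairwise crossing edges within \<open>S\<close> misses exactly one point \<open>z\<close> of \<open>S\<close> and
  contains all edges that halve \<open>S - {z}\<close>; such an edge has \<open>k\<close> points of \<open>S\<close> on one side and \<open>k + 1\<close> on the
  other. Up to a common sign, its coefficient is positive if \<open>p\<close> lies on the side with \<open>k + 1\<close> points
  and negative if \<open>p\<close> lies on the other side.

  Now take a hexagon \<open>a\<^sub>1 \<dots> a\<^sub>6\<close> of points of the configuration. Adding one point in each of the gaps
  \<open>a\<^sub>1a\<^sub>2\<close>, \<open>a\<^sub>3a\<^sub>4\<close>, \<open>a\<^sub>5a\<^sub>6\<close> gives \<open>9\<close> points, and so do the three other gaps; \<open>k - 3\<close> further points in each of
  the opposite gaps \<open>a\<^sub>1a\<^sub>2\<close> and \<open>a\<^sub>4a\<^sub>5\<close> give \<open>2k + 3\<close>. Both choices of \<open>S\<close> fit into \<open>2k + 6\<close> points. In each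
  of them the main diagonals \<open>a\<^sub>1a\<^sub>4\<close>, \<open>a\<^sub>2a\<^sub>5\<close>, \<open>a\<^sub>3a\<^sub>6\<close> have \<open>k\<close> and \<open>k + 1\<close> points on their sides, but the side
  with more points changes from one choice to the other. Let \<open>p\<close> be the intersection of \<open>a\<^sub>1a\<^sub>4\<close> and
  \<open>a\<^sub>3a\<^sub>6\<close>, which carry \<open>0\<close>. For one of the two choices the coefficient of \<open>a\<^sub>2a\<^sub>5\<close> is at most \<open>0\<close> too, and
  then each maximal crossing family contains one of the three diagonals, so the positive edges form
  a face. Each such family also contains one of three edges next to the diagonals, whose
  coefficients are at least \<open>0\<close>, so the negative edges form a face. As \<open>p\<close> is not on the line of one of
  these three edges, which is relevant, the stress contradicts the first paragraph
  (\<open>convex_polygon_carries_no_fan\<close>).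
\<close>


section \<open>Linear dependences and faces\<close>

lemma coset_eqI:
  fixes U :: "'v::real_vector set"
  assumes "subspace U" "x - y \<in> U"
  shows "x +o U = y +o U"
proof -
  have "\<exists>u'\<in>U. x + u = y + u'" if "u \<in> U" for u
    by (rule bexI[of _ "(x - y) + u"]) (auto intro: subspace_add assms that)
  moreover have "\<exists>u'\<in>U. y + u = x + u'" if "u \<in> U" for u
    by (rule bexI[of _ "u - (x - y)"]) (auto intro: subspace_diff assms that)
  ultimately show ?thesis
    unfolding elt_set_plus_def by blast
qed

lemma quotient_independentD:
  assumes "quotient_independent U v I" "(\<Sum>i\<in>I. c i *\<^sub>R v i) +o U = U" "i \<in> I"
  shows "c i = 0"
  using assms unfolding quotient_independent_def by blast

lemma finite_edges: "finite (edges n)"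
  by (rule finite_subset[of _ "{1..n} \<times> {1..n}"]) (auto simp: edges_def)

lemma dependence_between_faces_is_trivial:
  fixes v :: "edge \<Rightarrow> 'v::real_vector"
  assumes fan: "realizes_as_complete_fan k n v"
    and dep: "(\<Sum>e\<in>edges n. w e *\<^sub>R v e) = 0"
    and F: "{e \<in> relevant_edges k n. w e > 0} \<in> reduced_multiassociahedron k n" (is "?F \<in> ?\<Delta>")
    and G: "{e \<in> relevant_edges k n. w e < 0} \<in> reduced_multiassociahedron k n" (is "?G \<in> ?\<Delta>")
    and e: "e \<in> relevant_edges k n"
  shows "w e = 0"
proof -
  let ?I = "irrelevant_edges k n"
  define U where "U = span (v ` ?I)"
  have sub: "subspace U" unfolding U_def by simp
  have zero: "0 +o U = U" by (simp add: elt_set_plus_def)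
  have fanF: "\<And>F. F \<in> ?\<Delta> \<Longrightarrow> quotient_independent U v F"
    and fanI: "\<And>F G. F \<in> ?\<Delta> \<Longrightarrow> G \<in> ?\<Delta> \<Longrightarrow>
       quotient_cone U v F \<inter> quotient_cone U v G = quotient_cone U v (F \<inter> G)"
    using fan unfolding realizes_as_complete_fan_def complete_simplicial_fan_def Let_def U_def
    by blast+
  let ?x = "\<Sum>e\<in>?F. w e *\<^sub>R v e" and ?y = "\<Sum>e\<in>?G. (- w e) *\<^sub>R v e"
  let ?Z = "{e \<in> relevant_edges k n. w e = 0}"
  have fin: "finite ?F" "finite ?G" "finite ?Z" "finite ?I"
    by (auto intro: finite_subset[OF _ finite_edges[of n]]
        simp: relevant_edges_def irrelevant_edges_def)
  have "edges n = ?F \<union> (?G \<union> (?Z \<union> ?I))"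
    by (auto simp: relevant_edges_def irrelevant_edges_def)
  then have "0 = (\<Sum>e\<in>?F \<union> (?G \<union> (?Z \<union> ?I)). w e *\<^sub>R v e)"
    using dep by simp
  also have "\<dots> = ?x + (\<Sum>e\<in>?G \<union> (?Z \<union> ?I). w e *\<^sub>R v e)"
    using fin by (intro sum.union_disjoint) (auto simp: relevant_edges_def irrelevant_edges_def)
  also have "(\<Sum>e\<in>?G \<union> (?Z \<union> ?I). w e *\<^sub>R v e)
      = (\<Sum>e\<in>?G. w e *\<^sub>R v e) + (\<Sum>e\<in>?Z \<union> ?I. w e *\<^sub>R v e)"
    using fin by (intro sum.union_disjoint) (auto simp: relevant_edges_def irrelevant_edges_def)
  also have "(\<Sum>e\<in>?Z \<union> ?I. w e *\<^sub>R v e)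
      = (\<Sum>e\<in>?Z. w e *\<^sub>R v e) + (\<Sum>e\<in>?I. w e *\<^sub>R v e)"
    using fin by (intro sum.union_disjoint) (auto simp: relevant_edges_def irrelevant_edges_def)
  also have "(\<Sum>e\<in>?Z. w e *\<^sub>R v e) = 0"
    by (intro sum.neutral) auto
  finally have "?x - ?y = - (\<Sum>e\<in>?I. w e *\<^sub>R v e)"
    by (simp add: sum_negf algebra_simps eq_neg_iff_add_eq_0)
  moreover have "(\<Sum>e\<in>?I. w e *\<^sub>R v e) \<in> U"
    unfolding U_def by (intro span_sum span_scale span_base) auto
  ultimately have "?x - ?y \<in> U"
    using sub by (simp add: subspace_neg)
  then have eq: "?x +o U = ?y +o U"
    by (rule coset_eqI[OF sub])
  have "?x +o U \<in> quotient_cone U v ?F"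
    unfolding quotient_cone_def by (auto intro!: exI[of _ w])
  moreover have "?y +o U \<in> quotient_cone U v ?G"
    unfolding quotient_cone_def by (auto intro!: exI[of _ "\<lambda>e. - w e"] simp del: scaleR_minus_left)
  ultimately have "?x +o U \<in> quotient_cone U v (?F \<inter> ?G)"
    using eq fanI[OF F G] by auto
  moreover have "?F \<inter> ?G = {}" by auto
  ultimately have xU: "?x +o U = U"
    unfolding quotient_cone_def using zero by auto
  have "\<not> w e > 0"
  proof
    assume "w e > 0"
    with e have "e \<in> ?F" by simp
    then have "w e = 0" by (rule quotient_independentD[OF fanF[OF F] xU])
    with \<open>w e > 0\<close> show False by simp
  qed
  moreover have "\<not> w e < 0"
  proof
    assume "w e < 0"
    with e have "e \<in> ?G" by simp
    moreover have "?y +o U = U" using xU eq by simp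
    ultimately have "- w e = 0"
      by (intro quotient_independentD[OF fanF[OF G], of "\<lambda>e. - w e"])
    with \<open>w e < 0\<close> show False by simp
  qed
  ultimately show ?thesis by simp
qed


section \<open>Maximal crossing families\<close>

lemma crossing_firsts_and_seconds:
  assumes "pairwise crosses X" "(a, b) \<in> X" "(c, d) \<in> X" "(a, b) \<noteq> (c, d)"
  shows "a \<noteq> c" "b \<noteq> d" "a < c \<longleftrightarrow> b < d" "a < d" "c < b"
  using pairwiseD[OF assms] by (auto simp: crosses_def)

text \<open>
  Every other edge of the family has exactly one end strictly between \<open>a\<close> and \<open>b\<close>, and these ends are
  distinct.
\<close>
lemma card_between_ends:
  assumes X: "pairwise crosses X" "finite X" "card X = k + 1" "\<And>a b. (a, b) \<in> X \<Longrightarrow> a < b"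
    and ab: "(a, b) \<in> X"
  shows "card ((fst ` X \<union> snd ` X) \<inter> {a<..<b}) = k"
proof -
  define Y where "Y = X - {(a, b)}"
  \<comment> \<open>The end of an edge that lies between \<open>a\<close> and \<open>b\<close>.\<close>
  define f where "f = (\<lambda>(c, d). if a < c then c else d :: nat)"
  have *: "a \<noteq> c \<and> b \<noteq> d \<and> (a < c \<longleftrightarrow> b < d) \<and> a < d \<and> c < b" if "(c, d) \<in> Y" for c d
    using crossing_firsts_and_seconds[OF X(1) ab, of c d] that unfolding Y_def by auto
  have "inj_on f Y"
  proof (rule inj_onI, clarify)
    fix c d c' d' assume e: "(c, d) \<in> Y" "(c', d') \<in> Y" "f (c, d) = f (c', d')"
    show "c = c' \<and> d = d'"
    proof (rule ccontr)
      assume "\<not> ?thesis"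
      then have "(c, d) \<noteq> (c', d')" by simp
      then show False
        using e crossing_firsts_and_seconds[OF X(1), of c d c' d']
        unfolding Y_def f_def by (auto split: if_splits)
    qed
  qed
  moreover have "f ` Y = (fst ` X \<union> snd ` X) \<inter> {a<..<b}"
  proof (intro equalityI subsetI)
    fix m assume "m \<in> f ` Y"
    then obtain c d where cd: "(c, d) \<in> Y" "m = f (c, d)" by auto
    then have "(c, d) \<in> X" by (simp add: Y_def)
    then have "m \<in> fst ` X \<union> snd ` X" using cd(2) by (force simp: f_def)
    then show "m \<in> (fst ` X \<union> snd ` X) \<inter> {a<..<b}"
      using *[OF cd(1)] cd(2) by (auto simp: f_def)
  next
    fix m assume m: "m \<in> (fst ` X \<union> snd ` X) \<inter> {a<..<b}"
    then obtain c d where cd: "(c, d) \<in> X" "m = c \<or> m = d" by force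
    then have "(c, d) \<in> Y" using m by (auto simp: Y_def)
    then have "m = f (c, d)" using *[of c d] cd m by (auto simp: f_def)
    with \<open>(c, d) \<in> Y\<close> show "m \<in> f ` Y" by blast
  qed
  moreover have "card Y = k" using X ab by (simp add: Y_def)
  ultimately show ?thesis by (metis card_image)
qed

text \<open>
  The points are numbered \<open>0, \<dots>, 2k + 2\<close>. The edge \<open>uv\<close> halves the \<open>2k + 2\<close> points other than \<open>z\<close>: \<open>k\<close> of them
  lie between \<open>u\<close> and \<open>v\<close>.
\<close>
definition halving :: "nat \<Rightarrow> nat \<Rightarrow> nat \<Rightarrow> nat \<Rightarrow> bool" where
  "halving k z u v \<longleftrightarrow> u < v \<and> v \<le> 2 * k + 2 \<and> u \<noteq> z \<and> v \<noteq> z \<and>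
     v = (if u < z \<and> z < v then u + k + 2 else u + k + 1)"

text \<open>
  The ends of the \<open>k + 1\<close> edges are distinct, so they are all points but one. Each edge of the family
  halves these ends, which determines the partner of every end.
\<close>
lemma crossing_family_consists_of_halving_edges:
  assumes cross: "pairwise crosses X" and card: "card X = k + 1"
    and sub: "\<And>a b. (a, b) \<in> X \<Longrightarrow> a < b \<and> b \<le> 2 * k + 2"
  obtains z where "z \<le> 2 * k + 2" "\<And>u v. halving k z u v \<Longrightarrow> (u, v) \<in> X"
proof -
  define V where "V = fst ` X \<union> snd ` X"
  have fin: "finite X" using card by (metis card.infinite add_is_0 one_neq_zero)
  have "inj_on fst X"
    by (rule inj_onI) (use crossing_firsts_and_seconds[OF cross] in \<open>metis prod.collapse\<close>)
  moreover have "inj_on snd X"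
    by (rule inj_onI) (use crossing_firsts_and_seconds[OF cross] in \<open>metis prod.collapse\<close>)
  moreover have "fst ` X \<inter> snd ` X = {}"
  proof -
    have "a \<noteq> d" if "(a, b) \<in> X" "(c, d) \<in> X" for a b c d
    proof (cases "(a, b) = (c, d)")
      case True then show ?thesis using sub[OF that(1)] by auto
    next
      case False
      then show ?thesis using crossing_firsts_and_seconds(4)[OF cross that] by auto
    qed
    then show ?thesis by force
  qed
  ultimately have cardV: "card V = 2 * k + 2"
    unfolding V_def using fin card by (simp add: card_Un_disjoint card_image)
  have VN: "V \<subseteq> {..2 * k + 2}" unfolding V_def using sub by fastforce
  have "card ({..2 * k + 2} - V) = 1"
    using cardV VN by (subst card_Diff_subset) (auto intro: finite_subset)
  then obtain z where z: "{..2 * k + 2} - V = {z}" by (auto simp: card_1_singleton_iff)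
  then have V: "V = {..2 * k + 2} - {z}" and zle: "z \<le> 2 * k + 2" using VN by auto
  have between: "card (V \<inter> {a<..<b}) = k" if "(a, b) \<in> X" for a b
    unfolding V_def by (rule card_between_ends[OF cross fin card _ that]) (use sub in blast)
  have "(u, v) \<in> X" if h: "halving k z u v" for u v
  proof -
    have uv: "u \<in> V" "v \<in> V" "u < v" using h by (auto simp: V halving_def)
    have "V \<inter> {u<..<v} = (if u < z \<and> z < v then {u<..<v} - {z} else {u<..<v})"
      using h by (auto simp: V halving_def)
    then have cuv: "card (V \<inter> {u<..<v}) = k"
      using h by (auto simp: halving_def split: if_splits)
    have finV: "finite V" by (simp add: V)
    consider b where "(u, b) \<in> X" | a where "(a, u) \<in> X" using uv(1) unfolding V_def by force
    then show ?thesis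
    proof cases
      case (1 b)
      have bV: "b \<in> V" using 1 by (force simp: V_def)
      have ub: "u < b" using sub 1 by blast
      have False if "b < v"
      proof -
        have "V \<inter> {u<..<b} \<subset> V \<inter> {u<..<v}" using that bV ub by auto
        then have "card (V \<inter> {u<..<b}) < card (V \<inter> {u<..<v})"
          using finV by (intro psubset_card_mono) auto
        then show False using between[OF 1] cuv by simp
      qed
      moreover have False if "v < b"
      proof -
        have "V \<inter> {u<..<v} \<subset> V \<inter> {u<..<b}" using that uv by auto
        then have "card (V \<inter> {u<..<v}) < card (V \<inter> {u<..<b})"
          using finV by (intro psubset_card_mono) auto
        then show False using between[OF 1] cuv by simp
      qed
      ultimately have "b = v" by force
      with 1 show ?thesis by simp
    next
      case (2 a)
      have aV: "a \<in> V" using 2 by (force simp: V_def)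
      have au: "a < u" using sub 2 by blast
      \<comment> \<open>If \<open>u\<close> were a right end, then \<open>V\<close> would have \<open>k + k + 3\<close> elements between \<open>a\<close> and \<open>v\<close>.\<close>
      have "(V \<inter> {a<..<u}) \<union> (V \<inter> {u<..<v}) \<union> {a, u, v} \<subseteq> V" using aV uv by auto
      then have "card ((V \<inter> {a<..<u}) \<union> (V \<inter> {u<..<v}) \<union> {a, u, v}) \<le> card V"
        using finV by (rule card_mono[rotated])
      moreover have "card ((V \<inter> {a<..<u}) \<union> (V \<inter> {u<..<v}) \<union> {a, u, v}) = k + k + 3"
      proof -
        have "card ((V \<inter> {a<..<u}) \<union> (V \<inter> {u<..<v})) = k + k"
          using between[OF 2] cuv finV by (subst card_Un_disjoint) auto
        then show ?thesis using finV au uv(3) by (subst card_Un_disjoint) auto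
      qed
      ultimately show ?thesis using cardV by simp
    qed
  qed
  with zle that show ?thesis by blast
qed

definition edges_within :: "nat set \<Rightarrow> edge set" where
  "edges_within S = {(i, j). i \<in> S \<and> j \<in> S \<and> i < j}"

text \<open>
  Only edges within \<open>2k + 3\<close> selected points are involved, and crossing depends on their order alone.
  Hence edges that are short among the selected points need no attention, even where they are
  relevant in the large polygon.
\<close>
lemma face_if_every_halving_family_is_broken:
  assumes mono: "strict_mono_on {..2 * k + 2} s"
    and F: "F \<subseteq> relevant_edges k n" "F \<subseteq> edges_within (s ` {..2 * k + 2})"
    and broken: "\<And>z. z \<le> 2 * k + 2 \<Longrightarrow> \<exists>u v. halving k z u v \<and> (s u, s v) \<notin> F"
  shows "F \<in> reduced_multiassociahedron k n"
proof -
  have False if X: "X \<subseteq> F" "card X = k + 1" "pairwise crosses X" for X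
  proof -
    let ?N = "{..2 * k + 2}"
    have less: "s a < s b \<longleftrightarrow> a < b" if "a \<in> ?N" "b \<in> ?N" for a b
      using strict_mono_on_less[OF mono that] .
    define Y where "Y = {(u, v). u \<in> ?N \<and> v \<in> ?N \<and> (s u, s v) \<in> X}"
    have "map_prod s s ` Y = X"
    proof -
      have "X \<subseteq> map_prod s s ` Y"
      proof
        fix e assume e: "e \<in> X"
        then obtain u v where "u \<in> ?N" "v \<in> ?N" "e = (s u, s v)"
          using X(1) F(2) unfolding edges_within_def by blast
        with e show "e \<in> map_prod s s ` Y" by (force simp: Y_def)
      qed
      then show ?thesis by (auto simp: Y_def)
    qed
    moreover have "inj_on (map_prod s s) Y"
      using strict_mono_on_imp_inj_on[OF mono] by (auto simp: inj_on_def Y_def)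
    ultimately have "card Y = k + 1" using X(2) by (metis card_image)
    moreover have "pairwise crosses Y"
    proof -
      have "crosses (a, b) (c, d)" if e: "(a, b) \<in> Y" "(c, d) \<in> Y" "(a, b) \<noteq> (c, d)" for a b c d
      proof -
        have N: "a \<in> ?N" "b \<in> ?N" "c \<in> ?N" "d \<in> ?N" using e by (auto simp: Y_def)
        have "(s a, s b) \<noteq> (s c, s d)"
          using e(3) N strict_mono_on_imp_inj_on[OF mono] by (auto simp: inj_on_def)
        then have "crosses (s a, s b) (s c, s d)"
          using e X(3) by (auto simp: Y_def pairwise_def)
        then show ?thesis using N by (simp add: crosses_def less)
      qed
      then show ?thesis unfolding pairwise_def by force
    qed
    moreover have "a < b \<and> b \<le> 2 * k + 2" if "(a, b) \<in> Y" for a b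
    proof -
      have "(s a, s b) \<in> edges_within (s ` ?N)" using that X(1) F(2) by (auto simp: Y_def)
      then show ?thesis using that less[of a b] by (auto simp: Y_def edges_within_def)
    qed
    ultimately obtain z where "z \<le> 2 * k + 2" "\<And>u v. halving k z u v \<Longrightarrow> (u, v) \<in> Y"
      using crossing_family_consists_of_halving_edges by blast
    with broken[of z] X(1) show False by (fastforce simp: Y_def)
  qed
  then show ?thesis using F(1) unfolding reduced_multiassociahedron_def by blast
qed


section \<open>Signed areas and the stresses of small polygons\<close>

definition orient :: "(nat \<Rightarrow> real \<times> real) \<Rightarrow> nat \<Rightarrow> nat \<Rightarrow> nat \<Rightarrow> real" where
  "orient q i j m = (fst (q j) - fst (q i)) * (snd (q m) - snd (q i))
     - (fst (q m) - fst (q i)) * (snd (q j) - snd (q i))"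

lemma orient_rotate: "orient q j m i = orient q i j m"
  and orient_swap: "orient q j i m = - orient q i j m"
  and orient_swap_right: "orient q i m j = - orient q i j m"
  and orient_same: "orient q i i m = 0" "orient q i m i = 0" "orient q m i i = 0"
  by (simp_all add: orient_def algebra_simps)

text \<open>
  The three-term Grassmann-Pluecker relation for the directions from \<open>a\<close>.
\<close>
lemma orient_pluecker:
  "orient q a b c * orient q a d e + orient q a c d * orient q a b e
     = orient q a b d * orient q a c e"
  unfolding orient_def by algebra

definition convex_ccw :: "nat \<Rightarrow> (nat \<Rightarrow> real \<times> real) \<Rightarrow> bool" where
  "convex_ccw n q \<longleftrightarrow> (\<forall>i j m. 1 \<le> i \<longrightarrow> i < j \<longrightarrow> j < m \<longrightarrow> m \<le> n \<longrightarrow> 0 < orient q i j m)"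

lemma convex_ccwD:
  "convex_ccw n q \<Longrightarrow> 1 \<le> i \<Longrightarrow> i < j \<Longrightarrow> j < m \<Longrightarrow> m \<le> n \<Longrightarrow> 0 < orient q i j m"
  unfolding convex_ccw_def by blast

lemma prod_orient_sign:
  assumes q: "convex_ccw n q" and S: "S \<subseteq> {1..n}" and ij: "i \<in> S" "j \<in> S" "i < j"
  shows "0 < (-1) ^ card {m\<in>S. i < m \<and> m < j} * (\<Prod>m\<in>S - {i, j}. orient q i j m)"
proof -
  let ?B = "{m\<in>S. i < m \<and> m < j}" and ?C = "{m\<in>S. m < i \<or> j < m}"
  have fin: "finite ?B" "finite ?C" using finite_subset[OF S] by auto
  have "S - {i, j} = ?B \<union> ?C" using ij by auto
  then have "(\<Prod>m\<in>S - {i, j}. orient q i j m)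
      = (\<Prod>m\<in>?B. orient q i j m) * (\<Prod>m\<in>?C. orient q i j m)"
    using fin by (simp only:) (rule prod.union_disjoint; force)
  also have "(\<Prod>m\<in>?B. orient q i j m) = (\<Prod>m\<in>?B. (-1) * orient q i m j)"
    by (rule prod.cong) (auto simp: orient_swap_right[of q i j])
  also have "\<dots> = (-1) ^ card ?B * (\<Prod>m\<in>?B. orient q i m j)"
    by (simp only: prod.distrib prod_constant)
  finally have "(-1) ^ card ?B * (\<Prod>m\<in>S - {i, j}. orient q i j m)
      = ((-1) ^ card ?B * (-1) ^ card ?B) * ((\<Prod>m\<in>?B. orient q i m j) * (\<Prod>m\<in>?C. orient q i j m))"
    by (simp only: mult_ac)
  also have "(-1) ^ card ?B * (-1) ^ card ?B = (1::real)"
    by (simp flip: power_add)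
  finally have "(-1) ^ card ?B * (\<Prod>m\<in>S - {i, j}. orient q i j m)
      = (\<Prod>m\<in>?B. orient q i m j) * (\<Prod>m\<in>?C. orient q i j m)" by simp
  moreover have "0 < (\<Prod>m\<in>?B. orient q i m j)"
    using S ij by (intro prod_pos ballI convex_ccwD[OF q]) auto
  moreover have "0 < (\<Prod>m\<in>?C. orient q i j m)"
  proof (rule prod_pos)
    fix m assume m: "m \<in> ?C"
    then consider "m < i" "m \<in> S" | "j < m" "m \<in> S" by auto
    then show "0 < orient q i j m"
    proof cases
      case 1
      then have "0 < orient q m i j" using S ij by (intro convex_ccwD[OF q]) auto
      then show ?thesis by (simp add: orient_rotate[of q i j m])
    next
      case 2
      then show ?thesis using S ij by (intro convex_ccwD[OF q]) auto
    qed
  qed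
  ultimately show ?thesis by simp
qed

text \<open>
  The common property of the three matrices, for dimension \<open>d = 2k\<close>. Multiplying the
  stresses of the cofactor matrix of the points \<open>q\<close> by the weights \<open>c\<close> gives those of the matrix with
  rows \<open>v\<close>.
\<close>
definition carries_polygon_stresses ::
    "nat \<Rightarrow> nat \<Rightarrow> (nat \<Rightarrow> real \<times> real) \<Rightarrow> (nat \<Rightarrow> nat \<Rightarrow> real) \<Rightarrow> (edge \<Rightarrow> 'v::real_vector) \<Rightarrow> bool" where
  "carries_polygon_stresses d n q c v \<longleftrightarrow>
     (\<forall>T\<subseteq>{1..n}. card T = d + 2 \<longrightarrow>
        (\<Sum>(i, j)\<in>edges_within T. (c i j / (\<Prod>m\<in>T - {i, j}. orient q i j m)) *\<^sub>R v (i, j)) = 0)"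

lemma finite_edges_within:
  assumes "finite S" shows "finite (edges_within S)"
proof (rule finite_subset)
  show "edges_within S \<subseteq> S \<times> S" by (auto simp: edges_within_def)
  show "finite (S \<times> S)" using assms by simp
qed

text \<open>
  The stress of \<open>S - {a}\<close>, written with the denominators of \<open>S\<close>. The numerator becomes linear in \<open>a\<close>, so
  combinations of these stresses realize \<open>[ijp]\<close> for other points \<open>p\<close>.
\<close>
lemma stress_through_vertex:
  assumes v: "carries_polygon_stresses d n q c v" and q: "convex_ccw n q"
    and S: "S \<subseteq> {1..n}" "card S = d + 3" "a \<in> S"
  shows "(\<Sum>(i, j)\<in>edges_within S.
     (c i j * orient q i j a / (\<Prod>m\<in>S - {i, j}. orient q i j m)) *\<^sub>R v (i, j)) = 0"
proof -
  have fin: "finite S" using S(1) finite_subset by blast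
  let ?T = "S - {a}"
  have "(\<Sum>(i, j)\<in>edges_within S.
     (c i j * orient q i j a / (\<Prod>m\<in>S - {i, j}. orient q i j m)) *\<^sub>R v (i, j))
    = (\<Sum>(i, j)\<in>edges_within ?T.
     (c i j * orient q i j a / (\<Prod>m\<in>S - {i, j}. orient q i j m)) *\<^sub>R v (i, j))"
    using fin by (intro sum.mono_neutral_right finite_edges_within)
      (auto simp: edges_within_def orient_same)
  also have "\<dots> = (\<Sum>(i, j)\<in>edges_within ?T.
     (c i j / (\<Prod>m\<in>?T - {i, j}. orient q i j m)) *\<^sub>R v (i, j))"
  proof (rule sum.cong[OF refl], clarify)
    fix i j assume ij: "(i, j) \<in> edges_within ?T"
    then have "a \<in> S - {i, j}" using S(3) by (auto simp: edges_within_def)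
    then have "(\<Prod>m\<in>S - {i, j}. orient q i j m)
        = orient q i j a * (\<Prod>m\<in>S - {i, j} - {a}. orient q i j m)"
      using fin by (intro prod.remove) auto
    also have "S - {i, j} - {a} = ?T - {i, j}" by auto
    finally have P: "(\<Prod>m\<in>S - {i, j}. orient q i j m)
        = orient q i j a * (\<Prod>m\<in>?T - {i, j}. orient q i j m)" .
    have "0 < (-1) ^ card {m\<in>S. i < m \<and> m < j} * (\<Prod>m\<in>S - {i, j}. orient q i j m)"
      using ij by (intro prod_orient_sign[OF q S(1)]) (auto simp: edges_within_def)
    then have "orient q i j a \<noteq> 0" using P by auto
    then show "(c i j * orient q i j a / (\<Prod>m\<in>S - {i, j}. orient q i j m)) *\<^sub>R v (i, j)
        = (c i j / (\<Prod>m\<in>?T - {i, j}. orient q i j m)) *\<^sub>R v (i, j)"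
      unfolding P by simp
  qed
  also have "\<dots> = 0"
    using v S fin unfolding carries_polygon_stresses_def by (simp add: subset_insertI2 Diff_subset order_trans[of "S - {a}" S])
  finally show ?thesis .
qed

text \<open>
  The form \<open>P i j\<close> is \<open>[ijp]\<close> for the point \<open>p\<close> with homogeneous coordinates \<open>\<alpha> a + \<beta> b\<close>. For a halving edge
  \<open>side\<close> has the sign of the coefficient, because \<open>v - u - 1\<close> factors of the denominator are negative;
  the global factor \<open>(-1)^k\<close> makes it positive for \<open>p\<close> on the side with \<open>k + 1\<close> points. If each
  maximal crossing family has both a coefficient that is at most \<open>0\<close> and one that is at least \<open>0\<close>, then
  positive and negative edges form faces.
\<close>
lemma no_fan_if_stress_signs_balanced:
  fixes s :: "nat \<Rightarrow> nat"
  assumes fan: "realizes_as_complete_fan k n v"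
    and v: "carries_polygon_stresses (2 * k) n q c v" and q: "convex_ccw n q"
    and c: "\<And>i j. 1 \<le> i \<Longrightarrow> i < j \<Longrightarrow> j \<le> n \<Longrightarrow> 0 < c i j"
    and s: "strict_mono_on {..2 * k + 2} s" "s ` {..2 * k + 2} \<subseteq> {1..n}"
    and ab: "a \<in> s ` {..2 * k + 2}" "b \<in> s ` {..2 * k + 2}"
    and P: "\<And>i j. P i j = \<alpha> * orient q i j a + \<beta> * orient q i j b"
    and side: "\<And>u v. side u v = (if v = u + k + 1 then P (s u) (s v) else - P (s u) (s v))"
    and nonpos: "\<And>z. z \<le> 2 * k + 2 \<Longrightarrow> \<exists>u v. halving k z u v \<and> side u v \<le> 0"
    and nonneg: "\<And>z. z \<le> 2 * k + 2 \<Longrightarrow> \<exists>u v. halving k z u v \<and> side u v \<ge> 0"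
    and uv: "u < v'" "v' \<le> 2 * k + 2" "(s u, s v') \<in> relevant_edges k n"
  shows "P (s u) (s v') = 0"
proof -
  let ?N = "{..2 * k + 2}"
  define S where "S = s ` ?N"
  define \<pi> where "\<pi> = (\<lambda>i j. \<Prod>m\<in>S - {i, j}. orient q i j m)"
  define w where "w = (\<lambda>(i, j). if (i, j) \<in> edges_within S
     then (-1) ^ k * (c i j * P i j / \<pi> i j) else 0)"
  have inj: "inj_on s ?N" using s(1) by (rule strict_mono_on_imp_inj_on)
  have less: "s x < s y \<longleftrightarrow> x < y" if "x \<in> ?N" "y \<in> ?N" for x y
    using strict_mono_on_less[OF s(1) that] .
  have S: "S \<subseteq> {1..n}" "card S = 2 * k + 3"
    using s inj by (auto simp: S_def card_image)
  have fin: "finite S" by (simp add: S_def)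
  have W: "(\<Sum>(i, j)\<in>edges_within S. (c i j * orient q i j x / \<pi> i j) *\<^sub>R v (i, j)) = 0"
    if "x \<in> S" for x
    unfolding \<pi>_def by (rule stress_through_vertex[OF v q S that])
  have "(\<Sum>e\<in>edges n. w e *\<^sub>R v e) = (\<Sum>e\<in>edges_within S. w e *\<^sub>R v e)"
    using S(1) by (intro sum.mono_neutral_right finite_edges)
      (auto simp: edges_within_def edges_def w_def split: if_splits)
  also have "\<dots> = (\<Sum>(i, j)\<in>edges_within S.
      ((-1) ^ k * \<alpha>) *\<^sub>R ((c i j * orient q i j a / \<pi> i j) *\<^sub>R v (i, j))
      + ((-1) ^ k * \<beta>) *\<^sub>R ((c i j * orient q i j b / \<pi> i j) *\<^sub>R v (i, j)))"
  proof (rule sum.cong[OF refl], clarify)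
    fix i j assume "(i, j) \<in> edges_within S"
    then have "w (i, j) = (-1) ^ k * \<alpha> * (c i j * orient q i j a / \<pi> i j)
        + (-1) ^ k * \<beta> * (c i j * orient q i j b / \<pi> i j)"
      by (simp add: w_def P algebra_simps add_divide_distrib)
    then show "w (i, j) *\<^sub>R v (i, j) =
        ((-1) ^ k * \<alpha>) *\<^sub>R ((c i j * orient q i j a / \<pi> i j) *\<^sub>R v (i, j))
        + ((-1) ^ k * \<beta>) *\<^sub>R ((c i j * orient q i j b / \<pi> i j) *\<^sub>R v (i, j))"
      by (simp only: scaleR_add_left scaleR_scaleR)
  qed
  also have "\<dots> = ((-1) ^ k * \<alpha>) *\<^sub>R (\<Sum>(i, j)\<in>edges_within S. (c i j * orient q i j a / \<pi> i j) *\<^sub>R v (i, j))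
      + ((-1) ^ k * \<beta>) *\<^sub>R (\<Sum>(i, j)\<in>edges_within S. (c i j * orient q i j b / \<pi> i j) *\<^sub>R v (i, j))"
    by (simp add: split_def sum.distrib scaleR_sum_right)
  also have "\<dots> = 0" using W ab by (simp add: S_def)
  finally have dep: "(\<Sum>e\<in>edges n. w e *\<^sub>R v e) = 0" .
  have \<pi>_sign: "0 < (-1) ^ (y - x - 1) * \<pi> (s x) (s y)" and in_S: "(s x, s y) \<in> edges_within S"
    if xy: "x < y" "y \<le> 2 * k + 2" for x y
  proof -
    have "{m\<in>S. s x < m \<and> m < s y} = s ` {x<..<y}"
      using xy less by (auto simp: S_def)
    moreover have "card (s ` {x<..<y}) = y - x - 1"
      using xy by (subst card_image) (auto intro: inj_on_subset[OF inj])
    ultimately show "0 < (-1) ^ (y - x - 1) * \<pi> (s x) (s y)"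
      using prod_orient_sign[OF q S(1), of "s x" "s y"] less[of x y] xy by (simp add: \<pi>_def S_def)
    show "(s x, s y) \<in> edges_within S"
      using less[of x y] xy by (auto simp: edges_within_def S_def)
  qed
  have w_sign: "sgn (w (s x, s y)) = sgn (side x y)" if h: "halving k z x y" for x y z
  proof -
    have xy: "x < y" "y \<le> 2 * k + 2" using h by (auto simp: halving_def)
    have "s x \<in> {1..n}" "s y \<in> {1..n}" "s x < s y"
      using s(2) xy less[of x y] by (auto simp: image_subset_iff)
    then have cpos: "sgn (c (s x) (s y)) = 1" using c by simp
    have "sgn ((-1::real) ^ k) = (-1) ^ k" by (cases "even k") auto
    then have "sgn (w (s x, s y)) = (-1) ^ k * sgn (P (s x) (s y)) / sgn (\<pi> (s x) (s y))"
      using in_S[OF xy] cpos by (simp add: w_def sgn_mult sgn_divide)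
    moreover have "sgn (\<pi> (s x) (s y)) = (-1) ^ (y - x - 1)"
      using \<pi>_sign[OF xy] by (cases "even (y - x - 1)") auto
    moreover have "y = x + k + 1 \<or> y = x + k + 2" using h by (auto simp: halving_def split: if_splits)
    ultimately show ?thesis
      by (auto simp: side sgn_minus simp flip: power_add mult.assoc)
  qed
  have "{e \<in> relevant_edges k n. w e > 0} \<in> reduced_multiassociahedron k n"
  proof (rule face_if_every_halving_family_is_broken[OF s(1)])
    show "{e \<in> relevant_edges k n. w e > 0} \<subseteq> edges_within (s ` ?N)"
      by (auto simp: w_def S_def split: if_splits)
    fix z assume "z \<le> 2 * k + 2"
    from nonpos[OF this] obtain x y where "halving k z x y" "side x y \<le> 0" by blast
    with w_sign[of z x y] show "\<exists>x y. halving k z x y \<and> (s x, s y) \<notin> {e \<in> relevant_edges k n. w e > 0}"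
      by (intro exI[of _ x] exI[of _ y]) (auto simp: sgn_real_def split: if_splits)
  qed auto
  moreover have "{e \<in> relevant_edges k n. w e < 0} \<in> reduced_multiassociahedron k n"
  proof (rule face_if_every_halving_family_is_broken[OF s(1)])
    show "{e \<in> relevant_edges k n. w e < 0} \<subseteq> edges_within (s ` ?N)"
      by (auto simp: w_def S_def split: if_splits)
    fix z assume "z \<le> 2 * k + 2"
    from nonneg[OF this] obtain x y where "halving k z x y" "side x y \<ge> 0" by blast
    with w_sign[of z x y] show "\<exists>x y. halving k z x y \<and> (s x, s y) \<notin> {e \<in> relevant_edges k n. w e < 0}"
      by (intro exI[of _ x] exI[of _ y]) (auto simp: sgn_real_def split: if_splits)
  qed auto
  ultimately have "w (s u, s v') = 0"
    by (rule dependence_between_faces_is_trivial[OF fan dep _ _ uv(3)])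
  moreover have "0 < c (s u) (s v')"
    using s(2) less[of u v'] uv by (intro c) (auto simp: image_subset_iff)
  ultimately show ?thesis
    using in_S[OF uv(1,2)] \<pi>_sign[OF uv(1,2)] by (auto simp: w_def)
qed


section \<open>Two polygons sharing a hexagon\<close>

text \<open>
  The hexagon consists of the points \<open>1\<close>, \<open>k\<close>, \<open>k + 2\<close>, \<open>k + 4\<close>, \<open>2k + 3\<close>, \<open>2k + 5\<close>. Its gaps contain \<open>k - 2\<close>, \<open>1\<close>, \<open>1\<close>,
  \<open>k - 2\<close>, \<open>1\<close>, \<open>1\<close> of the first \<open>2k + 6\<close> points, the last of these coming after \<open>a\<^sub>6\<close>. Either choice of \<open>S\<close>
  leaves out one point in each of three alternate gaps. The sign of \<open>P a\<^sub>2 a\<^sub>5\<close>, which says on which side of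
  the diagonal \<open>a\<^sub>2a\<^sub>5\<close> the intersection of the two others lies, decides which choice is
  contradictory.
\<close>
lemma convex_polygon_carries_no_fan:
  assumes fan: "realizes_as_complete_fan k n v"
    and v: "carries_polygon_stresses (2 * k) n q c v" and q: "convex_ccw n q"
    and c: "\<And>i j. 1 \<le> i \<Longrightarrow> i < j \<Longrightarrow> j \<le> n \<Longrightarrow> 0 < c i j"
    and k: "3 \<le> k" and n: "2 * k + 6 \<le> n"
  shows False
proof -
  let ?a1 = 1 and ?a2 = k and ?a3 = "k + 2" and ?a4 = "k + 4" and ?a5 = "2 * k + 3" and ?a6 = "2 * k + 5"
  let ?D = "orient q"
  note pos = convex_ccwD[OF q]
  define \<alpha> where "\<alpha> = ?D ?a3 ?a4 ?a6"
  define \<beta> where "\<beta> = ?D ?a1 ?a3 ?a6"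
  define \<gamma> where "\<gamma> = ?D ?a1 ?a4 ?a6"
  define \<delta> where "\<delta> = ?D ?a1 ?a3 ?a4"
  define P where "P = (\<lambda>i j. \<alpha> * ?D i j ?a1 + \<beta> * ?D i j ?a4)"
  have greek: "0 < \<alpha>" "0 < \<beta>" "0 < \<gamma>" "0 < \<delta>"
    using k n by (auto simp: \<alpha>_def \<beta>_def \<gamma>_def \<delta>_def intro!: pos)
  \<comment> \<open>The intersection of \<open>a\<^sub>1a\<^sub>4\<close> and \<open>a\<^sub>3a\<^sub>6\<close> is a positive combination of the ends of either diagonal.\<close>
  have P': "P i j = \<gamma> * ?D i j ?a3 + \<delta> * ?D i j ?a6" for i j
    unfolding P_def \<alpha>_def \<beta>_def \<gamma>_def \<delta>_def orient_def by algebra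
  have P_swap: "P j i = - P i j" for i j
    unfolding P_def using orient_swap[of q i j] by simp
  have P_pluecker: "?D x y y' * P x z = ?D x z y' * P x y + ?D x y z * P x y'" for x y y' z
  proof -
    have "?D x y y' * ?D x z e = ?D x z y' * ?D x y e + ?D x y z * ?D x y' e" for e
      unfolding orient_def by algebra
    from this[of ?a1] this[of ?a4] show ?thesis unfolding P_def by algebra
  qed
  have P14: "P ?a1 ?a4 = 0" by (simp add: P_def orient_same)
  have P36: "P ?a3 ?a6 = 0" by (simp add: P' orient_same)
  show False
  proof (cases "P ?a2 ?a5 \<le> 0")
    case True
    let ?y = "k + 3" and ?z = "2 * k + 4"
    \<comment> \<open>Leave out \<open>k + 1\<close>, \<open>k + 5\<close> and \<open>2k + 6\<close>; the side of \<open>a\<^sub>2a\<^sub>5\<close> with \<open>k\<close> points is that of \<open>a\<^sub>3\<close> and \<open>a\<^sub>4\<close>.\<close>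
    define s where "s = (\<lambda>u. if u < k then u + 1 else if u \<le> k + 2 then u + 2 else u + 3)"
    define side where "side = (\<lambda>u v. if v = u + k + 1 then P (s u) (s v) else - P (s u) (s v))"
    have s: "s 0 = ?a1" "s (k - 1) = ?a2" "s k = ?a3" "s (k + 1) = ?y" "s (k + 2) = ?a4"
      "s (2 * k) = ?a5" "s (2 * k + 1) = ?z" "s (2 * k + 2) = ?a6"
      using k by (auto simp: s_def)
    have "0 < ?D ?a1 ?y ?a4" using k n by (intro pos) auto
    then have y1: "0 < P ?a1 ?y" using greek by (simp add: P_def orient_same)
    have "0 < ?D ?a3 ?y ?a6" using k n by (intro pos) auto
    then have "0 < ?D ?y ?a6 ?a3" using orient_rotate[of q ?y ?a6 ?a3] by simp
    then have y6: "0 < P ?y ?a6" using greek by (simp add: P' orient_same)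
    \<comment> \<open>Seen from \<open>a\<^sub>2\<close>, the point \<open>z\<close> is in the cone of \<open>a\<^sub>5\<close> and \<open>a\<^sub>6\<close>.\<close>
    have z2: "P ?a2 ?z \<le> 0"
    proof -
      have "0 < ?D ?a2 ?z ?a6" "0 < ?D ?a2 ?a5 ?z" "0 < ?D ?a2 ?a5 ?a6" "0 < ?D ?a2 ?a3 ?a6"
        using k n by (auto intro!: pos)
      moreover from this have "P ?a2 ?a6 < 0"
        using greek orient_swap_right[of q ?a2 ?a3 ?a6] by (simp add: P' orient_same mult_less_0_iff)
      ultimately have "?D ?a2 ?z ?a6 * P ?a2 ?a5 \<le> 0" "?D ?a2 ?a5 ?z * P ?a2 ?a6 \<le> 0"
        and "0 < ?D ?a2 ?a5 ?a6"
        using True by (simp_all add: mult_le_0_iff)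
      moreover from this have "?D ?a2 ?a5 ?a6 * P ?a2 ?z \<le> 0"
        using P_pluecker[of ?a2 ?a5 ?a6 ?z] by linarith
      ultimately show ?thesis by (simp add: mult_le_0_iff)
    qed
    have sides: "side 0 (k + 2) \<le> 0" "side (k - 1) (2 * k) \<le> 0" "side k (2 * k + 2) \<le> 0"
      "0 \<le> side 0 (k + 1)" "0 \<le> side (k + 1) (2 * k + 2)" "0 \<le> side (k - 1) (2 * k + 1)"
      using k True y1 y6 z2 P14 P36 unfolding side_def s by auto
    have "P (s 0) (s (k + 1)) = 0"
    proof (rule no_fan_if_stress_signs_balanced[OF fan v q c, of s ?a1 ?a4 P \<alpha> \<beta> side])
      show "strict_mono_on {..2 * k + 2} s" by (rule strict_mono_onI) (auto simp: s_def)
      show "s ` {..2 * k + 2} \<subseteq> {1..n}" using n by (auto simp: s_def)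
      show "?a1 \<in> s ` {..2 * k + 2}" using s(1) by (intro image_eqI[of _ _ 0]) auto
      show "?a4 \<in> s ` {..2 * k + 2}" using s(5) by (intro image_eqI[of _ _ "k + 2"]) auto
      show "(s 0, s (k + 1)) \<in> relevant_edges k n"
        unfolding s using n by (auto simp: relevant_edges_def edges_def edge_length_def)
      fix z assume z: "z \<le> 2 * k + 2"
      have "halving k z 0 (k + 2) \<or> halving k z (k - 1) (2 * k) \<or> halving k z k (2 * k + 2)"
      proof -
        consider "0 < z \<and> z \<le> k + 1" | "z = 0 \<or> z = 2 * k + 2" | "k + 1 < z \<and> z < 2 * k + 2"
          using z by linarith
        then show ?thesis by cases (use k in \<open>auto simp: halving_def\<close>)
      qed
      with sides show "\<exists>u v. halving k z u v \<and> side u v \<le> 0" by blast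
      have "halving k z 0 (k + 1) \<or> halving k z (k + 1) (2 * k + 2) \<or> halving k z (k - 1) (2 * k + 1)"
      proof -
        consider "k + 1 < z" | "z < k + 1" | "z = k + 1"
          using z by linarith
        then show ?thesis by cases (use k in \<open>auto simp: halving_def\<close>)
      qed
      with sides show "\<exists>u v. halving k z u v \<and> side u v \<ge> 0" by blast
    qed (auto simp: P_def side_def)
    with y1 show False by (simp only: s less_irrefl)
  next
    case False
    let ?x = "k + 1" and ?r = "2 * k + 6"
    \<comment> \<open>Leave out \<open>2\<close>, \<open>k + 3\<close> and \<open>2k + 4\<close>; the side of \<open>a\<^sub>2a\<^sub>5\<close> with \<open>k\<close> points is that of \<open>a\<^sub>6\<close> and \<open>a\<^sub>1\<close>.\<close>
    define s where "s = (\<lambda>u. if u = 0 then 1 else if u \<le> k then u + 2 else if u \<le> 2 * k then u + 3 else u + 4)"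
    define side where "side = (\<lambda>u v. if v = u + k + 1 then P (s u) (s v) else - P (s u) (s v))"
    have s: "s 0 = ?a1" "s (k - 2) = ?a2" "s (k - 1) = ?x" "s k = ?a3" "s (k + 1) = ?a4"
      "s (2 * k) = ?a5" "s (2 * k + 1) = ?a6" "s (2 * k + 2) = ?r"
      using k by (auto simp: s_def)
    have "0 < ?D ?a1 ?a4 ?r" using k n by (intro pos) auto
    then have "0 < ?D ?a4 ?r ?a1" using orient_rotate[of q ?a4 ?r ?a1] by simp
    then have r4: "0 < P ?a4 ?r" using greek by (simp add: P_def orient_same)
    have "0 < ?D ?a3 ?a6 ?r" using k n by (intro pos) auto
    then have "?D ?a3 ?r ?a6 < 0" using orient_swap_right[of q ?a3 ?r ?a6] by simp
    then have r3: "P ?a3 ?r < 0" using greek by (simp add: P' orient_same mult_less_0_iff)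
    \<comment> \<open>Seen from \<open>a\<^sub>5\<close>, the point \<open>x\<close> is in the cone of \<open>a\<^sub>2\<close> and \<open>a\<^sub>3\<close>.\<close>
    have x5: "0 \<le> P ?x ?a5"
    proof -
      have "0 < ?D ?a2 ?a3 ?a5" "0 < ?D ?x ?a3 ?a5" "0 < ?D ?a2 ?x ?a5" "0 < ?D ?a3 ?a5 ?a6"
        using k n by (auto intro!: pos)
      then have D: "0 < ?D ?a5 ?a2 ?a3" "0 < ?D ?a5 ?x ?a3" "0 < ?D ?a5 ?a2 ?x" "?D ?a5 ?a3 ?a6 < 0"
        using orient_rotate[of q ?a2 ?a3 ?a5] orient_rotate[of q ?x ?a3 ?a5]
          orient_rotate[of q ?a2 ?x ?a5] orient_swap[of q ?a5 ?a3 ?a6] by linarith+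
      then have "P ?a5 ?a3 < 0"
        using greek by (simp add: P' orient_same mult_less_0_iff)
      then have "?D ?a5 ?x ?a3 * P ?a5 ?a2 \<le> 0" "?D ?a5 ?a2 ?x * P ?a5 ?a3 \<le> 0"
        using False D P_swap[of ?a5 ?a2] by (simp_all add: mult_le_0_iff)
      then have "?D ?a5 ?a2 ?a3 * P ?a5 ?x \<le> 0"
        using P_pluecker[of ?a5 ?a2 ?a3 ?x] by linarith
      with D(1) P_swap[of ?a5 ?x] show ?thesis by (simp add: zero_le_mult_iff)
    qed
    have sides: "side 0 (k + 1) \<le> 0" "side (k - 2) (2 * k) \<le> 0" "side k (2 * k + 1) \<le> 0"
      "0 \<le> side (k + 1) (2 * k + 2)" "0 \<le> side k (2 * k + 2)" "0 \<le> side (k - 1) (2 * k)"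
      using k False r4 r3 x5 P14 P36 unfolding side_def s by auto
    have "P (s (k + 1)) (s (2 * k + 2)) = 0"
    proof (rule no_fan_if_stress_signs_balanced[OF fan v q c, of s ?a1 ?a4 P \<alpha> \<beta> side])
      show "strict_mono_on {..2 * k + 2} s" by (rule strict_mono_onI) (auto simp: s_def)
      show "s ` {..2 * k + 2} \<subseteq> {1..n}" using n by (auto simp: s_def)
      show "?a1 \<in> s ` {..2 * k + 2}" using s(1) by (intro image_eqI[of _ _ 0]) auto
      show "?a4 \<in> s ` {..2 * k + 2}" using s(5) by (intro image_eqI[of _ _ "k + 1"]) auto
      show "(s (k + 1), s (2 * k + 2)) \<in> relevant_edges k n"
        unfolding s using n by (auto simp: relevant_edges_def edges_def edge_length_def)
      fix z assume z: "z \<le> 2 * k + 2"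
      have "halving k z 0 (k + 1) \<or> halving k z (k - 2) (2 * k) \<or> halving k z k (2 * k + 1)"
      proof -
        consider "k + 1 < z" | "k \<le> z \<and> z \<le> k + 1" | "z < k"
          using z by linarith
        then show ?thesis by cases (use k in \<open>auto simp: halving_def\<close>)
      qed
      with sides show "\<exists>u v. halving k z u v \<and> side u v \<le> 0" by blast
      have "halving k z (k + 1) (2 * k + 2) \<or> halving k z k (2 * k + 2) \<or> halving k z (k - 1) (2 * k)"
      proof -
        consider "z < k + 1" | "k < z \<and> z < 2 * k + 2" | "z = 2 * k + 2"
          using z by linarith
        then show ?thesis by cases (use k in \<open>auto simp: halving_def\<close>)
      qed
      with sides show "\<exists>u v. halving k z u v \<and> side u v \<ge> 0" by blast
    qed (auto simp: P_def side_def)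
    with r4 show False by (simp only: s less_irrefl)
  qed
qed


section \<open>The rigidity rows carry the polygon stresses\<close>

text \<open>
  The homogeneous form of the vanishing of divided differences of polynomials of low degree. A linear
  form in the vectors \<open>(x j, y j)\<close> is a combination of \<open>D j g\<close> and \<open>D j h\<close>, for two members \<open>g\<close>, \<open>h\<close> of the
  family. Splitting off one linear factor of the monomial in this way cancels a factor of the
  denominator, which leaves sums over \<open>A - {g}\<close> and \<open>A - {h}\<close>.
\<close>
lemma sum_binary_forms_over_pairwise_determinants:
  fixes x y :: "'a \<Rightarrow> real"
  defines "D \<equiv> \<lambda>i j. x i * y j - x j * y i"
  assumes "finite A" "card A = a + b + 2"
    and "\<And>i j. i \<in> A \<Longrightarrow> j \<in> A \<Longrightarrow> i \<noteq> j \<Longrightarrow> D i j \<noteq> 0"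
  shows "(\<Sum>j\<in>A. x j ^ a * y j ^ b / (\<Prod>m\<in>A - {j}. D j m)) = 0"
  using assms(2-)
proof (induction "a + b" arbitrary: a b A)
  case 0
  then have "card A = 2" by simp
  then obtain i j where A: "A = {i, j}" "i \<noteq> j" by (auto simp: card_2_iff)
  then have "A - {i} = {j}" "A - {j} = {i}" by auto
  moreover have "D i j \<noteq> 0" using 0 A by auto
  moreover have "D j i = - D i j" by (simp add: D_def)
  ultimately show ?case using 0 A by simp
next
  case (Suc r)
  have "card A = Suc (Suc (Suc r))" using Suc by simp
  then obtain g h where gh: "g \<in> A" "h \<in> A" "g \<noteq> h"
    by (metis card_le_Suc0_iff_eq Suc.prems(1) Suc_le_mono not_less_eq_eq zero_le)
  have Dgh: "D g h \<noteq> 0" using Suc gh by simp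
  have drop: "(\<Sum>j\<in>A. x j ^ a' * y j ^ b' * D j e / (\<Prod>m\<in>A - {j}. D j m)) = 0"
    if e: "e \<in> A" and r: "r = a' + b'" for a' b' e
  proof -
    have "(\<Sum>j\<in>A. x j ^ a' * y j ^ b' * D j e / (\<Prod>m\<in>A - {j}. D j m))
      = (\<Sum>j\<in>A - {e}. x j ^ a' * y j ^ b' * D j e / (\<Prod>m\<in>A - {j}. D j m))"
      using Suc.prems(1) e by (intro sum.mono_neutral_right) (auto simp: D_def)
    also have "\<dots> = (\<Sum>j\<in>A - {e}. x j ^ a' * y j ^ b' / (\<Prod>m\<in>A - {e} - {j}. D j m))"
    proof (rule sum.cong[OF refl])
      fix j assume j: "j \<in> A - {e}"
      then have "(\<Prod>m\<in>A - {j}. D j m) = D j e * (\<Prod>m\<in>A - {j} - {e}. D j m)"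
        using Suc.prems(1) e by (intro prod.remove) auto
      moreover have "A - {j} - {e} = A - {e} - {j}" by auto
      moreover have "D j e \<noteq> 0" using Suc.prems(3) j e by auto
      ultimately show "x j ^ a' * y j ^ b' * D j e / (\<Prod>m\<in>A - {j}. D j m)
          = x j ^ a' * y j ^ b' / (\<Prod>m\<in>A - {e} - {j}. D j m)" by simp
    qed
    also have "\<dots> = 0"
      using Suc.prems e Suc.hyps(2) r by (intro Suc.hyps(1)) auto
    finally show ?thesis .
  qed
  have split: "(\<Sum>j\<in>A. x j ^ a' * y j ^ b' * (\<mu> * D j h - \<nu> * D j g) / (\<Prod>m\<in>A - {j}. D j m)) = 0"
    if "r = a' + b'" for a' b' \<mu> \<nu>
  proof -
    have "(\<Sum>j\<in>A. x j ^ a' * y j ^ b' * (\<mu> * D j h - \<nu> * D j g) / (\<Prod>m\<in>A - {j}. D j m))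
      = \<mu> * (\<Sum>j\<in>A. x j ^ a' * y j ^ b' * D j h / (\<Prod>m\<in>A - {j}. D j m))
        - \<nu> * (\<Sum>j\<in>A. x j ^ a' * y j ^ b' * D j g / (\<Prod>m\<in>A - {j}. D j m))"
      by (simp add: sum_distrib_left sum_subtractf[symmetric] algebra_simps diff_divide_distrib)
    then show ?thesis using drop[OF gh(1) that] drop[OF gh(2) that] by simp
  qed
  have x: "x j = x g / D g h * D j h - x h / D g h * D j g"
    and y: "y j = y g / D g h * D j h - y h / D g h * D j g" for j
  proof -
    have "x j * D g h = x g * D j h - x h * D j g" "y j * D g h = y g * D j h - y h * D j g"
      by (simp_all add: D_def algebra_simps)
    then show "x j = x g / D g h * D j h - x h / D g h * D j g"
      and "y j = y g / D g h * D j h - y h / D g h * D j g"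
      using Dgh by (simp_all add: field_simps)
  qed
  show ?case
  proof (cases a)
    case (Suc a')
    have E: "x j ^ a * y j ^ b = x j ^ a' * y j ^ b * (x g / D g h * D j h - x h / D g h * D j g)" for j
      by (subst x[symmetric]) (simp add: Suc mult_ac)
    have "r = a' + b" using Suc.hyps(2) Suc by simp
    then show ?thesis unfolding E by (rule split)
  next
    case 0
    then obtain b' where b: "b = Suc b'" using Suc.hyps(2) by (cases b) auto
    have E: "x j ^ a * y j ^ b = x j ^ a * y j ^ b' * (y g / D g h * D j h - y h / D g h * D j g)" for j
      by (subst y[symmetric]) (simp add: b mult_ac)
    have "r = a + b'" using Suc.hyps(2) b by simp
    then show ?thesis unfolding E by (rule split)
  qed
qed

lemma sum_rows_apply: "(\<Sum>e\<in>E. f e) b s = (\<Sum>e\<in>E. f e b s)" for f :: "'a \<Rightarrow> row"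
  by (induction E rule: infinite_finite_induct) auto

text \<open>
  The two blocks of a row arise from a single function \<open>g\<close>, evaluated at both orders of the ends. With
  symmetric weights the dependence then splits into one equation for each vertex and column, in which
  the order of the points is irrelevant.
\<close>
lemma row_dependence_blockwise:
  assumes v: "\<And>i j. i < j \<Longrightarrow> v (i, j) = block_row d (i, j) (g i j) (g j i)"
    and W: "\<And>i j. i \<in> T \<Longrightarrow> j \<in> T \<Longrightarrow> W i j = W j i" and T: "finite T"
    and eq: "\<And>b s. b \<in> T \<Longrightarrow> s < d \<Longrightarrow> (\<Sum>j\<in>T - {b}. W b j * g b j s) = 0"
  shows "(\<Sum>(i, j)\<in>edges_within T. W i j *\<^sub>R v (i, j)) = 0"
proof (intro ext)
  fix b s
  let ?E = "edges_within T"
  define h where "h = (\<lambda>(i, j). W i j * v (i, j) b s)"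
  have fin: "finite ?E" by (rule finite_edges_within[OF T])
  have "(\<Sum>(i, j)\<in>?E. W i j *\<^sub>R v (i, j)) b s = (\<Sum>e\<in>?E. h e)"
    unfolding sum_rows_apply by (rule sum.cong) (auto simp: h_def scaleR_fun_def)
  also have "\<dots> = 0"
  proof (cases "b \<in> T \<and> s < d")
    case False
    then have "h e = 0" if "e \<in> ?E" for e
      using that by (auto simp: h_def edges_within_def v block_row_def)
    then show ?thesis by simp
  next
    case True
    let ?R = "{j\<in>T. b < j}" and ?L = "{i\<in>T. i < b}"
    have "(\<Sum>e\<in>?E. h e) = (\<Sum>e\<in>Pair b ` ?R \<union> (\<lambda>i. (i, b)) ` ?L. h e)"
    proof (rule sum.mono_neutral_right[OF fin])
      show "Pair b ` ?R \<union> (\<lambda>i. (i, b)) ` ?L \<subseteq> ?E" using True by (auto simp: edges_within_def)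
      have "i = b \<or> j = b" if "h (i, j) \<noteq> 0" "i < j" for i j
        using that by (auto simp: h_def v block_row_def split: if_splits)
      then show "\<forall>e\<in>?E - (Pair b ` ?R \<union> (\<lambda>i. (i, b)) ` ?L). h e = 0"
        unfolding edges_within_def by blast
    qed
    also have "\<dots> = (\<Sum>e\<in>Pair b ` ?R. h e) + (\<Sum>e\<in>(\<lambda>i. (i, b)) ` ?L. h e)"
      using T by (intro sum.union_disjoint) auto
    also have "(\<Sum>e\<in>Pair b ` ?R. h e) = (\<Sum>j\<in>?R. W b j * g b j s)"
      using True by (subst sum.reindex) (auto simp: inj_on_def h_def v block_row_def)
    also have "(\<Sum>e\<in>(\<lambda>i. (i, b)) ` ?L. h e) = (\<Sum>j\<in>?L. W b j * g b j s)"
      using True W by (subst sum.reindex) (auto simp: inj_on_def h_def v block_row_def intro!: sum.cong)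
    also have "(\<Sum>j\<in>?R. W b j * g b j s) + (\<Sum>j\<in>?L. W b j * g b j s)
        = (\<Sum>j\<in>?R \<union> ?L. W b j * g b j s)"
      using T by (intro sum.union_disjoint[symmetric]) auto
    also have "?R \<union> ?L = T - {b}" by auto
    finally show ?thesis using eq True by simp
  qed
  finally show "(\<Sum>(i, j)\<in>?E. W i j *\<^sub>R v (i, j)) b s = 0 b s" by simp
qed

text \<open>
  Exchanging \<open>i\<close> and \<open>j\<close> changes the sign of each of the \<open>d\<close> factors.
\<close>
lemma prod_orient_commute:
  assumes "even d" "finite T" "card T = d + 2" "i \<in> T" "j \<in> T"
  shows "(\<Prod>m\<in>T - {i, j}. orient q i j m) = (\<Prod>m\<in>T - {j, i}. orient q j i m)"
proof (cases "i = j")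
  case False
  have "card (T - {j, i}) = d" using assms False by (simp add: card_Diff_subset)
  have "(\<Prod>m\<in>T - {i, j}. orient q i j m) = (\<Prod>m\<in>T - {j, i}. (-1) * orient q j i m)"
    by (rule prod.cong) (auto simp: orient_swap[of q i j])
  also have "\<dots> = (-1) ^ card (T - {j, i}) * (\<Prod>m\<in>T - {j, i}. orient q j i m)"
    by (simp only: prod.distrib prod_constant)
  finally show ?thesis using assms(1) \<open>card (T - {j, i}) = d\<close> by simp
qed simp

lemma carries_polygon_stressesI:
  assumes v: "\<And>i j. i < j \<Longrightarrow> v (i, j) = block_row d (i, j) (g i j) (g j i)"
    and "even d" and c: "\<And>i j. c i j = c j i"
    and eq: "\<And>T b s. T \<subseteq> {1..n} \<Longrightarrow> finite T \<Longrightarrow> card T = d + 2 \<Longrightarrow> b \<in> T \<Longrightarrow> s < d \<Longrightarrow>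
      (\<Sum>j\<in>T - {b}. c b j * g b j s / (\<Prod>m\<in>T - {b} - {j}. orient q b j m)) = 0"
  shows "carries_polygon_stresses d n q c v"
  unfolding carries_polygon_stresses_def
proof (intro allI impI)
  fix T assume T: "T \<subseteq> {1..n}" "card T = d + 2"
  have fin: "finite T" using T(1) finite_subset by blast
  show "(\<Sum>(i, j)\<in>edges_within T. (c i j / (\<Prod>m\<in>T - {i, j}. orient q i j m)) *\<^sub>R v (i, j)) = 0"
  proof (rule row_dependence_blockwise[OF v _ fin])
    show "c i j / (\<Prod>m\<in>T - {i, j}. orient q i j m) = c j i / (\<Prod>m\<in>T - {j, i}. orient q j i m)"
      if "i \<in> T" "j \<in> T" for i j
      using prod_orient_commute[OF \<open>even d\<close> fin T(2) that] c[of i j] by simp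
    show "(\<Sum>j\<in>T - {b}. c b j / (\<Prod>m\<in>T - {b, j}. orient q b j m) * g b j s) = 0"
      if "b \<in> T" "s < d" for b s
      using eq[OF T(1) fin T(2) that] by (simp add: Diff_insert2[symmetric] insert_commute)
  qed
qed

lemma convex_ccw_nonzero:
  assumes q: "convex_ccw n q" and "{i, j, m} \<subseteq> {1..n}" "i \<noteq> j" "i \<noteq> m" "j \<noteq> m"
  shows "orient q i j m \<noteq> 0"
proof -
  have pos: "0 < orient q a b c" if "a \<in> {1..n}" "c \<in> {1..n}" "a < b" "b < c" for a b c
    using that by (intro convex_ccwD[OF q]) auto
  note r = orient_rotate[of q i j m] orient_rotate[of q j m i]
    orient_swap[of q i j m] orient_swap[of q j m i] orient_swap[of q m i j]
  have "i < j \<and> j < m \<or> i < m \<and> m < j \<or> j < i \<and> i < m \<or> j < m \<and> m < i \<or> m < i \<and> i < j \<or> m < j \<and> j < i"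
    using assms(3-) by linarith
  then show ?thesis
    using pos[of i m j] pos[of i j m] pos[of j i m] pos[of j m i] pos[of m i j] pos[of m j i] r assms(2)
      orient_swap_right[of q i j m]
    by auto
qed

lemma cofactor_row_carries_polygon_stresses:
  assumes q: "\<And>i j m. {i, j, m} \<subseteq> {1..n} \<Longrightarrow> i \<noteq> j \<Longrightarrow> i \<noteq> m \<Longrightarrow> j \<noteq> m \<Longrightarrow> orient q i j m \<noteq> 0"
    and d: "even d"
  shows "carries_polygon_stresses d n q (\<lambda>_ _. 1) (cofactor_row d q)"
proof (rule carries_polygon_stressesI[where g = "\<lambda>i j. cofactor_vector d (q i) (q j)", OF _ d])
  have neg: "cofactor_vector d (q j) (q i) s = - cofactor_vector d (q i) (q j) s" if "s < d" for i j s
  proof -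
    have "fst (q j) - fst (q i) = (-1) * (fst (q i) - fst (q j))"
      "snd (q j) - snd (q i) = (-1) * (snd (q i) - snd (q j))" by auto
    then have "cofactor_vector d (q j) (q i) s
        = ((-1) ^ (d - 1 - s) * (-1) ^ s) * cofactor_vector d (q i) (q j) s"
      unfolding cofactor_vector_def by (simp only: power_mult_distrib mult_ac)
    also have "(-1) ^ (d - 1 - s) * (-1) ^ s = (-1::real)"
      using that d by (simp flip: power_add)
    finally show ?thesis by simp
  qed
  show "cofactor_row d q (i, j)
      = block_row d (i, j) (cofactor_vector d (q i) (q j)) (cofactor_vector d (q j) (q i))" for i j
    by (intro ext) (simp add: cofactor_row_def block_row_def neg[where i = i and j = j])
  show "(\<Sum>j\<in>T - {b}. 1 * cofactor_vector d (q b) (q j) s / (\<Prod>m\<in>T - {b} - {j}. orient q b j m)) = 0"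
    if T: "T \<subseteq> {1..n}" "finite T" "card T = d + 2" "b \<in> T" "s < d" for T b s
  proof -
    let ?x = "\<lambda>j. fst (q b) - fst (q j)" and ?y = "\<lambda>j. snd (q b) - snd (q j)"
    have D: "?x i * ?y j - ?x j * ?y i = orient q b i j" for i j
      by (simp add: orient_def algebra_simps)
    have "(\<Sum>j\<in>T - {b}. ?x j ^ (d - 1 - s) * ?y j ^ s
        / (\<Prod>m\<in>T - {b} - {j}. ?x j * ?y m - ?x m * ?y j)) = 0"
    proof (rule sum_binary_forms_over_pairwise_determinants)
      show "?x i * ?y j - ?x j * ?y i \<noteq> 0" if "i \<in> T - {b}" "j \<in> T - {b}" "i \<noteq> j" for i j
        unfolding D using T that by (intro q) auto
    qed (use T in auto)
    then show ?thesis by (simp add: D cofactor_vector_def)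
  qed
qed simp

subsection \<open>Points on a parabola\<close>

definition parabola :: "(nat \<Rightarrow> real) \<Rightarrow> nat \<Rightarrow> real \<times> real" where
  "parabola t i = (t i, (t i)\<^sup>2)"

lemma orient_parabola: "orient (parabola t) i j m = (t j - t i) * (t m - t i) * (t m - t j)"
  by (simp add: orient_def parabola_def power2_eq_square algebra_simps)

lemma convex_ccw_parabola:
  assumes "strict_mono_on {1..n} t"
  shows "convex_ccw n (parabola t)"
  unfolding convex_ccw_def orient_parabola
  using strict_mono_onD[OF assms] by (auto intro!: mult_pos_pos)

text \<open>
  The area \<open>[bjm]\<close> is the product \<open>(t\<^sub>j - t\<^sub>b) (t\<^sub>m - t\<^sub>b) (t\<^sub>m - t\<^sub>j)\<close>. In the denominator the first factor
  contributes the power \<open>(t\<^sub>j - t\<^sub>b)^d\<close>, the second one a quantity independent of \<open>j\<close> divided by \<open>t\<^sub>j - t\<^sub>b\<close>, and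
  the third one the determinants of the vectors \<open>(1, t\<^sub>j)\<close>.
\<close>
lemma sum_powers_over_parabola_areas:
  assumes inj: "inj_on t T" and T: "finite T" "card T = d + 2" "b \<in> T" and s: "s < d"
  shows "(\<Sum>j\<in>T - {b}. (t j - t b) ^ (d - 1) * t j ^ s
    / (\<Prod>m\<in>T - {b} - {j}. orient (parabola t) b j m)) = 0"
proof -
  define K where "K = (\<Prod>m\<in>T - {b}. t m - t b)"
  have "(t j - t b) ^ (d - 1) * t j ^ s / (\<Prod>m\<in>T - {b} - {j}. orient (parabola t) b j m)
      = 1 / K * (1 ^ (d - 1 - s) * t j ^ s / (\<Prod>m\<in>T - {b} - {j}. 1 * t m - 1 * t j))"
    if j: "j \<in> T - {b}" for j
  proof -
    let ?u = "t j - t b" and ?L = "\<Prod>m\<in>T - {b} - {j}. t m - t b"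
    have u: "?u \<noteq> 0" using j T inj by (auto dest: inj_onD)
    have "card (T - {b} - {j}) = d" using j T by simp
    then have "(\<Prod>m\<in>T - {b} - {j}. orient (parabola t) b j m)
        = ?u ^ d * ?L * (\<Prod>m\<in>T - {b} - {j}. t m - t j)"
      by (simp only: orient_parabola prod.distrib prod_constant)
    moreover have "?u ^ d = ?u ^ (d - 1) * ?u" using s by (cases d) auto
    moreover have "K = ?u * ?L" unfolding K_def using j T by (intro prod.remove) auto
    ultimately have "(\<Prod>m\<in>T - {b} - {j}. orient (parabola t) b j m)
        = ?u ^ (d - 1) * (K * (\<Prod>m\<in>T - {b} - {j}. t m - t j))"
      by (simp only: mult_ac)
    with u show ?thesis by simp
  qed
  then have "(\<Sum>j\<in>T - {b}. (t j - t b) ^ (d - 1) * t j ^ s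
      / (\<Prod>m\<in>T - {b} - {j}. orient (parabola t) b j m))
    = 1 / K * (\<Sum>j\<in>T - {b}. 1 ^ (d - 1 - s) * t j ^ s / (\<Prod>m\<in>T - {b} - {j}. 1 * t m - 1 * t j))"
    unfolding sum_distrib_left by (intro sum.cong) auto
  also have "(\<Sum>j\<in>T - {b}. 1 ^ (d - 1 - s) * t j ^ s / (\<Prod>m\<in>T - {b} - {j}. 1 * t m - 1 * t j)) = 0"
    by (rule sum_binary_forms_over_pairwise_determinants)
      (use T s inj in \<open>auto dest: inj_onD\<close>)
  finally show ?thesis by simp
qed

text \<open>
  The signs in the two blocks of a row turn the power of \<open>\<bar>t\<^sub>j - t\<^sub>b\<bar>\<close> into one of \<open>t\<^sub>j - t\<^sub>b\<close>, since \<open>d - 1\<close> is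
  odd.
\<close>
lemma hyperconnectivity_row_carries_polygon_stresses:
  assumes t: "strict_mono_on {1..n} t" and d: "even d"
  shows "carries_polygon_stresses d n (parabola t) (\<lambda>i j. \<bar>t j - t i\<bar> ^ (d - 1))
    (hyperconnectivity_row d (\<lambda>i s. t i ^ s))"
proof (rule carries_polygon_stressesI[where g = "\<lambda>i j s. (if i < j then 1 else -1) * t j ^ s", OF _ d])
  show "hyperconnectivity_row d (\<lambda>i s. t i ^ s) (i, j) = block_row d (i, j)
      (\<lambda>s. (if i < j then 1 else -1) * t j ^ s) (\<lambda>s. (if j < i then 1 else -1) * t i ^ s)"
    if "i < j" for i j
    using that by (simp add: hyperconnectivity_row_def)
  show "\<bar>t j - t i\<bar> ^ (d - 1) = \<bar>t i - t j\<bar> ^ (d - 1)" for i j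
    by (simp add: abs_minus_commute)
  show "(\<Sum>j\<in>T - {b}. \<bar>t j - t b\<bar> ^ (d - 1) * ((if b < j then 1 else -1) * t j ^ s)
      / (\<Prod>m\<in>T - {b} - {j}. orient (parabola t) b j m)) = 0"
    if T: "T \<subseteq> {1..n}" "finite T" "card T = d + 2" "b \<in> T" "s < d" for T b s
  proof -
    have inj: "inj_on t T" using strict_mono_on_imp_inj_on[OF t] T(1) inj_on_subset by blast
    have odd: "odd (d - 1)" using d T(5) by (cases d) auto
    have "\<bar>t j - t b\<bar> ^ (d - 1) * (if b < j then 1 else -1) = (t j - t b) ^ (d - 1)"
      if "j \<in> T - {b}" for j
    proof (cases "b < j")
      case True
      then have "t b < t j" using T that by (intro strict_mono_onD[OF t]) auto
      then show ?thesis using True by simp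
    next
      case False
      then have "t j < t b" using T that by (intro strict_mono_onD[OF t]) auto
      then have "(t j - t b) ^ (d - 1) = (- \<bar>t j - t b\<bar>) ^ (d - 1)" by simp
      then show ?thesis using False odd by (simp add: uminus_power_if)
    qed
    then have "(\<Sum>j\<in>T - {b}. \<bar>t j - t b\<bar> ^ (d - 1) * ((if b < j then 1 else -1) * t j ^ s)
        / (\<Prod>m\<in>T - {b} - {j}. orient (parabola t) b j m))
      = (\<Sum>j\<in>T - {b}. (t j - t b) ^ (d - 1) * t j ^ s
        / (\<Prod>m\<in>T - {b} - {j}. orient (parabola t) b j m))"
      by (intro sum.cong refl) (simp only: mult.assoc[symmetric])
    then show ?thesis using sum_powers_over_parabola_areas[OF inj T(2-5)] by simp
  qed
qed

text \<open>
  Dividing \<open>t\<^sub>b^(s+1) - t\<^sub>j^(s+1)\<close> by \<open>t\<^sub>j - t\<^sub>b\<close> leaves a polynomial of degree \<open>s\<close> in \<open>t\<^sub>j\<close>, so the weight needs one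
  factor less than in the hyperconnectivity matrix.
\<close>
lemma bar_joint_row_carries_polygon_stresses:
  assumes t: "strict_mono_on {1..n} t" and d: "even d"
  shows "carries_polygon_stresses d n (parabola t) (\<lambda>i j. (t j - t i) ^ (d - 2))
    (bar_joint_row d (\<lambda>i s. t i ^ (s + 1)))"
proof (rule carries_polygon_stressesI[where g = "\<lambda>i j s. t i ^ (s + 1) - t j ^ (s + 1)", OF _ d])
  show "bar_joint_row d (\<lambda>i s. t i ^ (s + 1)) (i, j) = block_row d (i, j)
      (\<lambda>s. t i ^ (s + 1) - t j ^ (s + 1)) (\<lambda>s. t j ^ (s + 1) - t i ^ (s + 1))" for i j
    by (simp add: bar_joint_row_def)
  show "(t j - t i) ^ (d - 2) = (t i - t j) ^ (d - 2)" for i j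
    using d uminus_power_if[of "t i - t j" "d - 2"] by simp
  show "(\<Sum>j\<in>T - {b}. (t j - t b) ^ (d - 2) * (t b ^ (s + 1) - t j ^ (s + 1))
      / (\<Prod>m\<in>T - {b} - {j}. orient (parabola t) b j m)) = 0"
    if T: "T \<subseteq> {1..n}" "finite T" "card T = d + 2" "b \<in> T" "s < d" for T b s
  proof -
    let ?\<Pi> = "\<lambda>j. \<Prod>m\<in>T - {b} - {j}. orient (parabola t) b j m"
    have inj: "inj_on t T" using strict_mono_on_imp_inj_on[OF t] T(1) inj_on_subset by blast
    have d1: "d - 1 = Suc (d - 2)" using d T(5) by (cases d) auto
    have "(t j - t b) ^ (d - 2) * (t b ^ (s + 1) - t j ^ (s + 1))
        = (\<Sum>r<Suc s. - (t b ^ (s - r)) * ((t j - t b) ^ (d - 1) * t j ^ r))" for j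
    proof -
      have "t b ^ (s + 1) - t j ^ (s + 1) = - ((t j - t b) * (\<Sum>r<Suc s. t j ^ r * t b ^ (s - r)))"
        using diff_power_eq_sum[of "t j" s "t b"] by simp
      then have "(t j - t b) ^ (d - 2) * (t b ^ (s + 1) - t j ^ (s + 1))
          = - ((t j - t b) ^ (d - 1) * (\<Sum>r<Suc s. t j ^ r * t b ^ (s - r)))"
        unfolding d1 by (simp only: power_Suc mult_minus_right mult_ac)
      then show ?thesis
        by (simp only: sum_distrib_left sum_negf mult_minus_left mult_minus_right mult_ac)
    qed
    then have "(\<Sum>j\<in>T - {b}. (t j - t b) ^ (d - 2) * (t b ^ (s + 1) - t j ^ (s + 1)) / ?\<Pi> j)
        = (\<Sum>j\<in>T - {b}. \<Sum>r<Suc s. - (t b ^ (s - r)) * ((t j - t b) ^ (d - 1) * t j ^ r / ?\<Pi> j))"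
      by (simp only: sum_divide_distrib times_divide_eq_right)
    also have "\<dots> = (\<Sum>r<Suc s. - (t b ^ (s - r)) * (\<Sum>j\<in>T - {b}. (t j - t b) ^ (d - 1) * t j ^ r / ?\<Pi> j))"
      by (subst sum.swap) (simp only: sum_distrib_left)
    also have "\<dots> = 0"
      using T(5) sum_powers_over_parabola_areas[OF inj T(2-4)] by (intro sum.neutral) auto
    finally show ?thesis .
  qed
qed


section \<open>Orientation of points in convex position\<close>

lemma normal_times_determinant:
  fixes a b x y u v :: real
  assumes "a * x + b * y = 0"
  shows "(a * y - b * x) * (x * v - u * y) = - ((x * x + y * y) * (a * u + b * v))"
  using assms by algebra

text \<open>
  A side of the polygon is an exposed face. Its supporting line contains no further point of the
  configuration, because such a point would be an extreme point of the side.
\<close>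
lemma convex_position_edge_supports:
  assumes q: "convex_position n q" and i: "i \<in> {1..<n}"
  obtains \<kappa> where "\<And>m. m \<in> {1..n} - {i, i + 1} \<Longrightarrow> 0 < \<kappa> * orient q i (i + 1) m"
proof -
  define P where "P = convex hull (q ` {1..n})"
  define F where "F = closed_segment (q i) (q (i + 1))"
  have inj: "inj_on q {1..n}" and ext: "{x. x extreme_point_of P} = q ` {1..n}"
    using q by (auto simp: convex_position_def Let_def P_def)
  have "F edge_of P"
    using q i by (auto simp: convex_position_def Let_def P_def F_def dest!: bspec[of _ _ i])
  then have "F exposed_face_of P"
    unfolding P_def edge_of_def by (subst exposed_face_of_polyhedron) (auto intro: polyhedron_convex_hull)
  then obtain a b where face: "F face_of P" and ab: "P \<subseteq> {x. a \<bullet> x \<le> b}" "F = P \<inter> {x. a \<bullet> x = b}"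
    unfolding exposed_face_of_def by blast
  define \<kappa> where "\<kappa> = fst a * (snd (q (i + 1)) - snd (q i)) - snd a * (fst (q (i + 1)) - fst (q i))"
  have "0 < \<kappa> * orient q i (i + 1) m" if m: "m \<in> {1..n} - {i, i + 1}" for m
  proof -
    have "q m extreme_point_of P" using ext m by auto
    then have qm: "q m \<in> P" "q m \<notin> F"
    proof -
      assume e: "q m extreme_point_of P"
      then show "q m \<in> P" by (simp add: extreme_point_of_def)
      show "q m \<notin> F"
      proof
        assume "q m \<in> F"
        then have "q m extreme_point_of F"
          using e face by (simp add: extreme_point_of_face)
        then have "q m = q i \<or> q m = q (i + 1)"
          by (simp add: F_def extreme_point_of_segment)
        then show False
          using inj_onD[OF inj, of m i] inj_onD[OF inj, of m "i + 1"] m i by auto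
      qed
    qed
    have "q i \<in> F" "q (i + 1) \<in> F" by (auto simp: F_def)
    then have "a \<bullet> q i = b" "a \<bullet> q (i + 1) = b" using ab by auto
    moreover have "a \<bullet> q m < b" using qm ab by force
    ultimately have dir: "a \<bullet> (q (i + 1) - q i) = 0" and neg: "a \<bullet> (q m - q i) < 0"
      by (auto simp: inner_diff_right)
    have "q (i + 1) \<noteq> q i" using inj_onD[OF inj, of "i + 1" i] i by auto
    then have pos: "0 < (norm (q (i + 1) - q i))\<^sup>2" by simp
    have "\<kappa> * orient q i (i + 1) m = - ((norm (q (i + 1) - q i))\<^sup>2 * (a \<bullet> (q m - q i)))"
      unfolding \<kappa>_def orient_def power2_norm_eq_inner inner_prod_def inner_real_def fst_diff snd_diff
      by (rule normal_times_determinant[OF dir[unfolded inner_prod_def inner_real_def fst_diff snd_diff]])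
    then show ?thesis using pos neg by (simp add: mult_less_0_iff)
  qed
  then show thesis by (rule that)
qed

text \<open>
  Seen from \<open>i\<close>, consecutive points turn counterclockwise, and all points are on one side of the ray
  through \<open>i + 1\<close>. In a half-plane turning counterclockwise is transitive, by the Pluecker relation.
\<close>
lemma convex_ccw_from_sides:
  assumes side: "\<And>i m. i \<in> {1..<n} \<Longrightarrow> m \<in> {1..n} - {i, i + 1} \<Longrightarrow> 0 < orient q i (i + 1) m"
  shows "convex_ccw n q"
  unfolding convex_ccw_def
proof (intro allI impI)
  fix i j m :: nat
  assume i: "1 \<le> i" "i < j" and "j < m" "m \<le> n"
  have next_pos: "0 < orient q i l (Suc l)" if "i < l" "Suc l \<le> n" for l
    using side[of l i] that i(1) orient_rotate[of q l "Suc l" i] by simp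
  have base_pos: "0 < orient q i (Suc i) l" if "Suc i < l" "l \<le> n" for l
    using side[of i l] that i(1) by simp
  have "Suc j \<le> m" using \<open>j < m\<close> by simp
  then have "m \<le> n \<longrightarrow> 0 < orient q i j m"
  proof (induction m rule: dec_induct)
    case base
    then show ?case using next_pos[of j] i by simp
  next
    case (step m)
    show ?case
    proof
      assume m: "Suc m \<le> n"
      show "0 < orient q i j (Suc m)"
      proof (cases "j = Suc i")
        case True
        then show ?thesis using base_pos[of "Suc m"] step m by simp
      next
        case False
        have "0 < orient q i (Suc i) j" "0 < orient q i (Suc i) m" "0 < orient q i (Suc i) (Suc m)"
          using False i step m by (auto intro!: base_pos)
        moreover have "0 < orient q i j m" "0 < orient q i m (Suc m)"
          using step m i by (auto intro!: next_pos)
        ultimately have "0 < orient q i (Suc i) j * orient q i m (Suc m)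
            + orient q i j m * orient q i (Suc i) (Suc m)"
          by (intro add_pos_pos mult_pos_pos)
        then have "0 < orient q i (Suc i) m * orient q i j (Suc m)"
          by (simp only: orient_pluecker)
        then show ?thesis using \<open>0 < orient q i (Suc i) m\<close> by (simp add: zero_less_mult_iff)
      qed
    qed
  qed
  then show "0 < orient q i j m" using \<open>m \<le> n\<close> by simp
qed

definition mirror :: "(nat \<Rightarrow> real \<times> real) \<Rightarrow> nat \<Rightarrow> real \<times> real" where
  "mirror q i = (fst (q i), - snd (q i))"

lemma orient_mirror: "orient (mirror q) i j m = - orient q i j m"
  by (simp add: orient_def mirror_def algebra_simps)

text \<open>
  Consecutive sides have the same orientation, because both orientations are that of the triangle
  \<open>i, i + 1, i + 2\<close>. A clockwise polygon becomes counterclockwise in a mirror.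
\<close>
lemma convex_position_imp_convex_ccw:
  assumes q: "convex_position n q" and n: "3 \<le> n"
  shows "convex_ccw n q \<or> convex_ccw n (mirror q)"
proof -
  have same_side: "0 < orient q i (i + 1) m * orient q i (i + 1) m'"
    if i: "i \<in> {1..<n}" and m: "m \<in> {1..n} - {i, i + 1}" "m' \<in> {1..n} - {i, i + 1}" for i m m'
  proof -
    obtain \<kappa> where "\<And>m. m \<in> {1..n} - {i, i + 1} \<Longrightarrow> 0 < \<kappa> * orient q i (i + 1) m"
      using convex_position_edge_supports[OF q i] by blast
    from this[OF m(1)] this[OF m(2)] show ?thesis
      by (auto simp: zero_less_mult_iff)
  qed
  define \<sigma> where "\<sigma> = orient q 1 2 3"
  have side: "0 < \<sigma> * orient q i (i + 1) m" if "i \<in> {1..<n}" "m \<in> {1..n} - {i, i + 1}" for i m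
  proof -
    from that(1) have "1 \<le> i" by simp
    then have "i < n \<longrightarrow> (\<forall>m \<in> {1..n} - {i, i + 1}. 0 < \<sigma> * orient q i (i + 1) m)"
    proof (induction i rule: dec_induct)
      case base
      show ?case using same_side[of 1 3] n by (auto simp: \<sigma>_def numeral_2_eq_2)
    next
      case (step i)
      show ?case
      proof (intro impI ballI)
        fix m assume i: "Suc i < n" and m: "m \<in> {1..n} - {Suc i, Suc i + 1}"
        have "0 < \<sigma> * orient q i (i + 1) (i + 2)" using step i by simp
        then have "0 < \<sigma> * orient q (Suc i) (Suc i + 1) i"
          using orient_rotate[of q "Suc i" "Suc i + 1" i] by simp
        moreover have "0 < orient q (Suc i) (Suc i + 1) i * orient q (Suc i) (Suc i + 1) m"
          using step i m by (intro same_side) auto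
        ultimately show "0 < \<sigma> * orient q (Suc i) (Suc i + 1) m"
          by (auto simp: zero_less_mult_iff)
      qed
    qed
    then show ?thesis using that by simp
  qed
  show ?thesis
  proof (cases "0 < \<sigma>")
    case True
    then have "convex_ccw n q"
      using side by (intro convex_ccw_from_sides) (auto simp: zero_less_mult_iff)
    then show ?thesis ..
  next
    case False
    then have "convex_ccw n (mirror q)"
      using side by (intro convex_ccw_from_sides) (fastforce simp: zero_less_mult_iff orient_mirror)
    then show ?thesis ..
  qed
qed

lemma carries_polygon_stresses_mirror:
  assumes "carries_polygon_stresses d n q c v" "even d"
  shows "carries_polygon_stresses d n (mirror q) c v"
  unfolding carries_polygon_stresses_def
proof (intro allI impI)
  fix T assume T: "T \<subseteq> {1..n}" "card T = d + 2"
  have "(\<Prod>m\<in>T - {i, j}. orient (mirror q) i j m) = (\<Prod>m\<in>T - {i, j}. orient q i j m)"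
    if "(i, j) \<in> edges_within T" for i j
  proof -
    have "card (T - {i, j}) = d"
      using that T(2) by (subst card_Diff_subset) (auto simp: edges_within_def)
    moreover have "(\<Prod>m\<in>T - {i, j}. orient (mirror q) i j m) = (\<Prod>m\<in>T - {i, j}. (-1) * orient q i j m)"
      by (simp add: orient_mirror)
    ultimately show ?thesis
      using \<open>even d\<close> by (simp only: prod.distrib prod_constant) simp
  qed
  then have "(\<Sum>(i, j)\<in>edges_within T. (c i j / (\<Prod>m\<in>T - {i, j}. orient (mirror q) i j m)) *\<^sub>R v (i, j))
      = (\<Sum>(i, j)\<in>edges_within T. (c i j / (\<Prod>m\<in>T - {i, j}. orient q i j m)) *\<^sub>R v (i, j))"
    by (intro sum.cong) auto
  then show "(\<Sum>(i, j)\<in>edges_within T. (c i j / (\<Prod>m\<in>T - {i, j}. orient (mirror q) i j m)) *\<^sub>R v (i, j)) = 0"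
    using assms(1) T unfolding carries_polygon_stresses_def by simp
qed


section \<open>Cofactor, bar-and-joint and hyperconnectivity matrices\<close>

theorem theorem1p9:
  fixes k n :: nat
  assumes "k \<ge> 3" and "n \<ge> 2 * k + 6"
  shows "(\<forall>q :: nat \<Rightarrow> real \<times> real. convex_position n q \<longrightarrow>
            \<not> realizes_as_complete_fan k n (cofactor_row (2 * k) q))
       \<and> (\<forall>t :: nat \<Rightarrow> real. strict_mono_on {1..n} t \<longrightarrow>
            \<not> realizes_as_complete_fan k n (bar_joint_row (2 * k) (\<lambda>i s. t i ^ (s + 1))))
       \<and> (\<forall>t :: nat \<Rightarrow> real. strict_mono_on {1..n} t \<longrightarrow>
            \<not> realizes_as_complete_fan k n (hyperconnectivity_row (2 * k) (\<lambda>i s. t i ^ s)))"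
proof (intro conjI allI impI notI)
  fix q :: "nat \<Rightarrow> real \<times> real"
  assume q: "convex_position n q" and fan: "realizes_as_complete_fan k n (cofactor_row (2 * k) q)"
  have "3 \<le> n" using assms by simp
  with q consider "convex_ccw n q" | "convex_ccw n (mirror q)"
    using convex_position_imp_convex_ccw by blast
  then show False
  proof cases
    case 1
    have "carries_polygon_stresses (2 * k) n q (\<lambda>_ _. 1) (cofactor_row (2 * k) q)"
      using convex_ccw_nonzero[OF 1] by (intro cofactor_row_carries_polygon_stresses) auto
    then show False
      using convex_polygon_carries_no_fan[OF fan _ 1 _ assms, of "\<lambda>_ _. 1"] by simp
  next
    case 2
    have "orient q i j m \<noteq> 0"
      if "{i, j, m} \<subseteq> {1..n}" "i \<noteq> j" "i \<noteq> m" "j \<noteq> m" for i j m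
      using convex_ccw_nonzero[OF 2 that] by (simp add: orient_mirror)
    then have "carries_polygon_stresses (2 * k) n q (\<lambda>_ _. 1) (cofactor_row (2 * k) q)"
      by (intro cofactor_row_carries_polygon_stresses) auto
    then have "carries_polygon_stresses (2 * k) n (mirror q) (\<lambda>_ _. 1) (cofactor_row (2 * k) q)"
      by (rule carries_polygon_stresses_mirror) simp
    then show False
      using convex_polygon_carries_no_fan[OF fan _ 2 _ assms, of "\<lambda>_ _. 1"] by simp
  qed
next
  fix t :: "nat \<Rightarrow> real"
  assume t: "strict_mono_on {1..n} t"
    and fan: "realizes_as_complete_fan k n (bar_joint_row (2 * k) (\<lambda>i s. t i ^ (s + 1)))"
  have v: "carries_polygon_stresses (2 * k) n (parabola t) (\<lambda>i j. (t j - t i) ^ (2 * k - 2))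
      (bar_joint_row (2 * k) (\<lambda>i s. t i ^ (s + 1)))"
    using t by (rule bar_joint_row_carries_polygon_stresses) simp
  have "0 < (t j - t i) ^ (2 * k - 2)" if "1 \<le> i" "i < j" "j \<le> n" for i j
    using that strict_mono_onD[OF t, of i j] by simp
  then show False
    using convex_polygon_carries_no_fan[OF fan v convex_ccw_parabola[OF t] _ assms] by blast
next
  fix t :: "nat \<Rightarrow> real"
  assume t: "strict_mono_on {1..n} t"
    and fan: "realizes_as_complete_fan k n (hyperconnectivity_row (2 * k) (\<lambda>i s. t i ^ s))"
  have v: "carries_polygon_stresses (2 * k) n (parabola t) (\<lambda>i j. \<bar>t j - t i\<bar> ^ (2 * k - 1))
      (hyperconnectivity_row (2 * k) (\<lambda>i s. t i ^ s))"
    using t by (rule hyperconnectivity_row_carries_polygon_stresses) simp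
  have "0 < \<bar>t j - t i\<bar> ^ (2 * k - 1)" if "1 \<le> i" "i < j" "j \<le> n" for i j
    using that strict_mono_onD[OF t, of i j] by simp
  then show False
    using convex_polygon_carries_no_fan[OF fan v convex_ccw_parabola[OF t] _ assms] by blast
qed

end
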